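(* Let $\mathbb{A}$ be a finite set, let $s\ge1$ be an integer, and let $\{X_t\}$ be a stationary $s$-step Markov process assuming values in $\mathbb{A}$, with $(s+1)$-tuple frequency vector $\boldsymbol{\mu}\in\mathcal{M}_s(\mathbb{A}^{s+1})$, $\mu_{\mathbf{i}}=\Pr\{X_t X_{t+1}\cdots X_{t+s}=\mathbf{i}\}$. Suppose $\mu_{\mathbf{i}}>0$ for all $\mathbf{i}\in\mathbb{A}^{s+1}$. For a sample path $x_1^l=x_1\cdots x_l$ (with $l\ge s$), form the augmented path $x_1\cdots x_l x_1\cdots x_s$ (that is, $x_{l+r}:=x_r$ for $1\le r\le s$) and define $$\nu_{\mathbf{i}}(x_1^l):=\frac1l\sum_{t=1}^{l}I_{\{x_tx_{t+1}\cdots x_{t+s}=\mathbf{i}\}},\qquad \mathbf{i}\in\mathbb{A}^{s+1}.$$ Then the $\mathcal{M}_s(\mathbb{A}^{s+1})$-valued process $\{\boldsymbol{\nu}(x_1^l)\}$ satisfies the large deviation property with rate function $$I(\boldsymbol{\nu}):=D_c(\boldsymbol{\nu}\Vert\boldsymbol{\mu})=D(\boldsymbol{\nu}\Vert\boldsymbol{\mu})-D(\bar{\boldsymbol{\nu}}\Vert\bar{\boldsymbol{\mu}}),\qquad\boldsymbol{\nu}\in\mathcal{M}_s(\mathbb{A}^{s+1}).$$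
   Context: $\mathbb{A}=\{1,\dots,n\}$ is a finite set of $n$ symbols, and $I_{\{\cdot\}}$ denotes an indicator function. A process $\{X_t\}$ is $s$-step Markov if for all $t\ge s$ the conditional distribution of $X_t$ given $X_0,\dots,X_{t-1}$ equals its conditional distribution given $X_{t-s},\dots,X_{t-1}$. Stationary distributions: a probability distribution $\boldsymbol{\nu}$ on $\mathbb{A}^2$ is stationary if $\sum_{j\in\mathbb{A}}\nu_{ij}=\sum_{j\in\mathbb{A}}\nu_{ji}$ for all $i\in\mathbb{A}$. For $k\ge2$, a probability distribution $\boldsymbol{\nu}$ on $\mathbb{A}^{k+1}$ is stationary if $\sum_{j\in\mathbb{A}}\nu_{\mathbf{i}j}=\sum_{j\in\mathbb{A}}\nu_{j\mathbf{i}}$ for all $\mathbf{i}\in\mathbb{A}^k$ and the resulting distribution $\bar{\boldsymbol{\nu}}$ on $\mathbb{A}^k$, $\bar\nu_{\mathbf{i}}:=\sum_{j}\nu_{\mathbf{i}j}$, is itself stationary. $\mathcal{M}_s(\mathbb{A}^{k})$ is the set of stationary distributions on $\mathbb{A}^{k}$ (the subscript $s$ in $\mathcal{M}_s$ stands for "stationary" and is unrelated to the integer $s$), viewed as a subset of $\mathbb{R}^{n^{k}}$ with the $\ell_1$-norm (total variation) topology. For $\boldsymbol{\nu}\in\mathcal{M}_s(\mathbb{A}^{s+1})$ the reduced distribution $\bar{\boldsymbol{\nu}}$ on $\mathbb{A}^s$ is $\bar\nu_{\mathbf{i}}=\sum_{j\in\mathbb{A}}\nu_{\mathbf{i}j}$,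 $\mathbf{i}\in\mathbb{A}^s$. The empirical measure $\boldsymbol{\nu}(x_1^l)$ always belongs to $\mathcal{M}_s(\mathbb{A}^{s+1})$. Relative entropy: $D(\boldsymbol{\nu}\Vert\boldsymbol{\mu})=\sum_i\nu_i\log(\nu_i/\mu_i)$ (sum over the underlying finite set, natural logarithm, $0\log0=0$). $D_c$ is called the conditional relative entropy. Large deviation property (LDP): let $\tilde P_\mu$ be the law of the process $\{X_t\}$ and let $\hat{\boldsymbol{\mu}}(x_1^l)$ be empirical distributions (functions of the first $l$ samples) taking values in a set $S$ of probability distributions, with the topology above. The process $\{\hat{\boldsymbol{\mu}}(x_1^l)\}$ satisfies the LDP with rate function $I:S\to\mathbb{R}\cup\{\infty\}$ if (1) for each open $\Gamma\subseteq S$, $-\inf_{\boldsymbol{\nu}\in\Gamma}I(\boldsymbol{\nu})\le\liminf_{l\to\infty}\frac1l\log\tilde P_\mu\{\hat{\boldsymbol{\mu}}(x_1^l)\in\Gamma\}$; and (2) for each closed $\Gamma\subseteq S$, $\limsup_{l\to\infty}\frac1l\log\tilde P_\mu\{\hat{\boldsymbol{\mu}}(x_1^l)\in\Gamma\}\le-\inf_{\boldsymbol{\nu}\in\Gamma}I(\boldsymbol{\nu})$. Conventions: $\log 0=-\infty$, $\inf\emptyset=+\infty$. Here $S=\mathcal{M}_s(\mathbb{A}^{s+1})$. *)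

theory Defs
  imports "HOL-Probability.Probability"
begin

text \<open>
  The finite alphabet is a type of class \<open>finite\<close>; its \<open>k\<close>-tuples are the lists of length \<open>k\<close>.
  A vector indexed by the \<open>k\<close>-tuples is a function on all lists that vanishes on lists of any
  other length, so that equality of functions is equality of vectors.
\<close>

definition tuples :: "nat \<Rightarrow> 'a::finite list set" where
  "tuples k = {xs. length xs = k}"

definition prob_dist :: "nat \<Rightarrow> ('a::finite list \<Rightarrow> real) \<Rightarrow> bool" where
  "prob_dist k \<nu> \<longleftrightarrow>
     (\<forall>i\<in>tuples k. 0 \<le> \<nu> i) \<and> (\<Sum>i\<in>tuples k. \<nu> i) = 1 \<and> (\<forall>i. i \<notin> tuples k \<longrightarrow> \<nu> i = 0)"

definition reduced_dist :: "('a::finite list \<Rightarrow> real) \<Rightarrow> 'a list \<Rightarrow> real" where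
  "reduced_dist \<nu> i = (\<Sum>j\<in>UNIV. \<nu> (i @ [j]))"

text \<open>
  The recursion is started at tuple length 0 only for uniformity: at lengths 0 and 1 it imposes
  no condition beyond being a distribution, so at length 2 it reduces to the balance condition
  alone (lemma \<open>stationary_2_iff\<close>).
\<close>

primrec stationary :: "nat \<Rightarrow> ('a::finite list \<Rightarrow> real) \<Rightarrow> bool" where
  "stationary 0 \<nu> \<longleftrightarrow> prob_dist 0 \<nu>"
| "stationary (Suc k) \<nu> \<longleftrightarrow>
     prob_dist (Suc k) \<nu> \<and>
     (\<forall>i\<in>tuples k. (\<Sum>j\<in>UNIV. \<nu> (i @ [j])) = (\<Sum>j\<in>UNIV. \<nu> (j # i))) \<and>
     stationary k (reduced_dist \<nu>)"

definition stationary_dists :: "nat \<Rightarrow> ('a::finite list \<Rightarrow> real) set" where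
  "stationary_dists k = {\<nu>. stationary k \<nu>}"

definition l1_dist :: "nat \<Rightarrow> ('a::finite list \<Rightarrow> real) \<Rightarrow> ('a list \<Rightarrow> real) \<Rightarrow> real" where
  "l1_dist k \<nu> \<mu> = (\<Sum>i\<in>tuples k. \<bar>\<nu> i - \<mu> i\<bar>)"

definition stationary_topology :: "nat \<Rightarrow> ('a::finite list \<Rightarrow> real) topology" where
  "stationary_topology k = Metric_space.mtopology (stationary_dists k) (l1_dist k)"

text \<open>
  The value is \<open>\<infinity>\<close> unless \<open>\<nu>\<close> is absolutely continuous with respect to \<open>\<mu>\<close>; the case
  distinction is needed because \<open>\<nu> i / 0 = 0\<close> and \<open>ln 0 = 0\<close> for reals.
\<close>

definition rel_entropy ::
    "nat \<Rightarrow> ('a::finite list \<Rightarrow> real) \<Rightarrow> ('a list \<Rightarrow> real) \<Rightarrow> ereal" where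
  "rel_entropy k \<nu> \<mu> =
     (\<Sum>i\<in>tuples k. if \<nu> i = 0 then 0 else if \<mu> i = 0 then \<infinity> else ereal (\<nu> i * ln (\<nu> i / \<mu> i)))"

definition cond_rel_entropy ::
    "nat \<Rightarrow> ('a::finite list \<Rightarrow> real) \<Rightarrow> ('a list \<Rightarrow> real) \<Rightarrow> ereal" where
  "cond_rel_entropy s \<nu> \<mu> =
     rel_entropy (s + 1) \<nu> \<mu> - rel_entropy s (reduced_dist \<nu>) (reduced_dist \<mu>)"

definition log_prob :: "real \<Rightarrow> ereal" where
  "log_prob p = (if p = 0 then - \<infinity> else ereal (ln p))"

text \<open>The state space of the process \<open>Y\<close> is \<open>topspace T\<close>.\<close>

definition satisfies_LDP ::
    "'w measure \<Rightarrow> 'b topology \<Rightarrow> ('b \<Rightarrow> ereal) \<Rightarrow> (nat \<Rightarrow> 'w \<Rightarrow> 'b) \<Rightarrow> bool" where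
  "satisfies_LDP M T I Y \<longleftrightarrow>
     (\<forall>\<Gamma>. openin T \<Gamma> \<longrightarrow>
        - (INF \<nu>\<in>\<Gamma>. I \<nu>) \<le>
          liminf (\<lambda>l. ereal (1 / real l) * log_prob (\<P>(\<omega> in M. Y l \<omega> \<in> \<Gamma>)))) \<and>
     (\<forall>\<Gamma>. closedin T \<Gamma> \<longrightarrow>
        limsup (\<lambda>l. ereal (1 / real l) * log_prob (\<P>(\<omega> in M. Y l \<omega> \<in> \<Gamma>))) \<le>
          - (INF \<nu>\<in>\<Gamma>. I \<nu>))"

definition block :: "(nat \<Rightarrow> 'w \<Rightarrow> 'a) \<Rightarrow> nat \<Rightarrow> nat \<Rightarrow> 'w \<Rightarrow> 'a list" where
  "block X t m \<omega> = map (\<lambda>r. X r \<omega>) [t..<t + m]"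

definition stationary_process :: "'w measure \<Rightarrow> (nat \<Rightarrow> 'w \<Rightarrow> 'a) \<Rightarrow> bool" where
  "stationary_process M X \<longleftrightarrow>
     (\<forall>ts h xs. \<P>(\<omega> in M. map (\<lambda>t. X (t + h) \<omega>) ts = xs) = \<P>(\<omega> in M. map (\<lambda>t. X t \<omega>) ts = xs))"

text \<open>
  Only pasts of positive probability are considered, as \<open>cond_prob\<close> given a null event is 0.
\<close>

definition markov_process :: "'w measure \<Rightarrow> nat \<Rightarrow> (nat \<Rightarrow> 'w \<Rightarrow> 'a) \<Rightarrow> bool" where
  "markov_process M s X \<longleftrightarrow>
     (\<forall>t\<ge>s. \<forall>xs a. \<P>(\<omega> in M. block X 0 t \<omega> = xs) > 0 \<longrightarrow>
        \<P>(\<omega> in M. X t \<omega> = a \<bar> block X 0 t \<omega> = xs) =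
        \<P>(\<omega> in M. X t \<omega> = a \<bar> block X (t - s) s \<omega> = drop (t - s) xs))"

text \<open>Lists are indexed from 0, so \<open>x\<^sub>t \<dots> x\<^sub>t\<^sub>+\<^sub>s\<close> starts after dropping \<open>t - 1\<close> entries.\<close>

definition empirical :: "nat \<Rightarrow> 'a::finite list \<Rightarrow> 'a list \<Rightarrow> real" where
  "empirical s xs i =
     (1 / real (length xs)) *
     (\<Sum>t = 1..length xs. of_bool (take (s + 1) (drop (t - 1) (xs @ take s xs)) = i))"


lemma finite_tuples [simp]: "finite (tuples k :: 'a::finite list set)"
  using finite_lists_length_eq[of "UNIV :: 'a set" k] by (simp add: tuples_def)

lemma tuples_0 [simp]: "tuples 0 = {[]}"
  by (auto simp: tuples_def)

lemma sum_tuples_Suc: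
  "(\<Sum>i\<in>tuples (Suc k). f i) = (\<Sum>i\<in>tuples k. \<Sum>j\<in>UNIV. f (i @ [j :: 'a::finite]))"
proof -
  have "(\<Sum>i\<in>tuples k. \<Sum>j\<in>UNIV. f (i @ [j])) = (\<Sum>(i, j)\<in>tuples k \<times> UNIV. f (i @ [j]))"
    by (rule sum.cartesian_product)
  also have "\<dots> = (\<Sum>i\<in>tuples (Suc k). f i)"
    by (rule sum.reindex_bij_witness[of _ "\<lambda>xs. (butlast xs, last xs)" "\<lambda>(i, j). i @ [j]"])
       (auto simp: tuples_def append_butlast_last_id simp flip: length_greater_0_conv)
  finally show ?thesis ..
qed

lemma prob_dist_reduced:
  assumes "prob_dist (Suc k) \<nu>"
  shows "prob_dist k (reduced_dist \<nu>)"
proof -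
  have "(\<Sum>i\<in>tuples k. reduced_dist \<nu> i) = 1"
    using assms by (simp add: prob_dist_def sum_tuples_Suc reduced_dist_def)
  moreover have "0 \<le> reduced_dist \<nu> i" if "i \<in> tuples k" for i
    using assms that by (auto simp: prob_dist_def reduced_dist_def tuples_def intro!: sum_nonneg)
  moreover have "reduced_dist \<nu> i = 0" if "i \<notin> tuples k" for i
    using assms that by (auto simp: prob_dist_def reduced_dist_def tuples_def intro!: sum.neutral)
  ultimately show ?thesis
    by (simp add: prob_dist_def)
qed

lemma stationary_1_iff: "stationary (Suc 0) \<nu> \<longleftrightarrow> prob_dist (Suc 0) \<nu>"
  using prob_dist_reduced by auto

lemma stationary_2_iff:
  fixes \<nu> :: "'a::finite list \<Rightarrow> real"
  shows "stationary 2 \<nu> \<longleftrightarrow>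
     prob_dist 2 \<nu> \<and> (\<forall>i. (\<Sum>j\<in>UNIV. \<nu> [i, j]) = (\<Sum>j\<in>UNIV. \<nu> [j, i]))"
proof -
  have t: "tuples (Suc 0) = range (\<lambda>i::'a. [i])"
    by (auto simp: tuples_def length_Suc_conv)
  have "stationary 2 \<nu> \<longleftrightarrow>
      prob_dist 2 \<nu> \<and> (\<forall>i. (\<Sum>j\<in>UNIV. \<nu> [i, j]) = (\<Sum>j\<in>UNIV. \<nu> [j, i])) \<and>
      stationary (Suc 0) (reduced_dist \<nu>)"
    unfolding numeral_2_eq_2 by (subst stationary.simps(2)) (simp add: t del: stationary.simps)
  then show ?thesis
    using prob_dist_reduced[of "Suc 0" \<nu>] by (auto simp only: stationary_1_iff numeral_2_eq_2)
qed

lemma stationary_imp_prob_dist: "stationary k \<nu> \<Longrightarrow> prob_dist k \<nu>"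
  by (cases k) auto

lemma Metric_space_stationary_dists:
  "Metric_space (stationary_dists k :: ('a::finite list \<Rightarrow> real) set) (l1_dist k)"
proof
  fix \<nu> \<mu> \<rho> :: "'a list \<Rightarrow> real"
  show "0 \<le> l1_dist k \<nu> \<mu>"
    by (simp add: l1_dist_def sum_nonneg)
  show "l1_dist k \<nu> \<mu> = l1_dist k \<mu> \<nu>"
    by (simp add: l1_dist_def abs_minus_commute)
  show "l1_dist k \<nu> \<rho> \<le> l1_dist k \<nu> \<mu> + l1_dist k \<mu> \<rho>"
    unfolding l1_dist_def sum.distrib[symmetric] by (rule sum_mono) linarith
  assume "\<nu> \<in> stationary_dists k" "\<mu> \<in> stationary_dists k"
  then have zero: "\<nu> i = 0" "\<mu> i = 0" if "i \<notin> tuples k" for i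
    using that by (auto simp: stationary_dists_def prob_dist_def dest!: stationary_imp_prob_dist)
  have "l1_dist k \<nu> \<mu> = 0 \<longleftrightarrow> (\<forall>i\<in>tuples k. \<nu> i = \<mu> i)"
    by (simp add: l1_dist_def sum_nonneg_eq_0_iff)
  also have "\<dots> \<longleftrightarrow> \<nu> = \<mu>"
    using zero by (metis ext)
  finally show "l1_dist k \<nu> \<mu> = 0 \<longleftrightarrow> \<nu> = \<mu>" .
qed

lemma topspace_stationary_topology [simp]:
  "topspace (stationary_topology k) = stationary_dists k"
  by (simp add: stationary_topology_def Metric_space.topspace_mtopology[OF Metric_space_stationary_dists])

end

theory Submission
  imports Defs "HOL-Real_Asymp.Real_Asymp"
begin

text \<open>
  Up to constant factors, a path \<open>x\<close> of length \<open>l\<close> has probability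
  \<open>exp (l * (\<Sum>i. \<nu> i * ln (q i)))\<close>, where \<open>\<nu>\<close> is its empirical measure and \<open>q\<close> the transition function
  of \<open>\<mu>\<close>. The number of paths of type \<open>\<nu>\<close> is bounded because the chain with the transitions of
  \<open>\<nu>\<close> itself has total mass at most one for each initial tuple, so the type \<open>\<nu>\<close> has probability at
  most a constant times \<open>exp (- l * D\<^sub>c(\<nu>\<parallel>\<mu>))\<close>. There are only polynomially many types, which gives
  the upper bound.

  The lower bound is a change of measure from \<open>\<mu>\<close> to a positive stationary \<open>\<kappa>\<close> near the target. The
  law of large numbers it needs for \<open>\<kappa>\<close> follows from the upper bound applied to \<open>\<kappa>\<close> in place of
  \<open>\<mu>\<close>: on the compact set of stationary distributions away from \<open>\<kappa>\<close> the continuous function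
  \<open>D\<^sub>c(\<cdot>\<parallel>\<kappa>)\<close> is bounded below by a positive constant, as its only zero is \<open>\<kappa>\<close>.
\<close>

subsection \<open>Empirical measures and path products\<close>

text \<open>The cyclic window of \<open>Suc k\<close> letters, with its start counted from 0 rather
  than from 1 as in \<open>empirical\<close>. The starts then range over
  \<open>{..<length xs}\<close>, and wrapping around can be written with \<open>mod\<close>.\<close>

definition window :: "nat \<Rightarrow> 'a list \<Rightarrow> nat \<Rightarrow> 'a list" where
  "window k xs t = take (Suc k) (drop t (xs @ take k xs))"

lemma empirical_eq_window:
  "empirical k xs i = (\<Sum>t<length xs. of_bool (window k xs t = i)) / real (length xs)"
proof -
  have "(\<Sum>t = 1..length xs. of_bool (take (k + 1) (drop (t - 1) (xs @ take k xs)) = i) :: real)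
      = (\<Sum>t<length xs. of_bool (window k xs t = i))"
    by (rule sum.reindex_bij_witness[of _ Suc "\<lambda>t. t - 1"]) (auto simp: window_def)
  then show ?thesis
    by (simp add: empirical_def)
qed

lemma window_in_tuples:
  "k \<le> length xs \<Longrightarrow> t < length xs \<Longrightarrow> window k xs t \<in> tuples (Suc k)"
  by (simp add: window_def tuples_def)

text \<open>Each window equals exactly one tuple, so swapping the sums leaves one term per start
  position. With \<open>f\<close> constant this gives the total mass, with \<open>f\<close> a
  logarithm the exponent of a path product.\<close>

lemma sum_empirical:
  fixes f :: "'a::finite list \<Rightarrow> real"
  assumes "k \<le> length xs"
  shows "(\<Sum>i\<in>tuples (Suc k). empirical k xs i * f i) = (\<Sum>t<length xs. f (window k xs t)) / real (length xs)"
proof -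
  have "(\<Sum>i\<in>tuples (Suc k). of_bool (window k xs t = i) * f i) = f (window k xs t)" if "t < length xs" for t
  proof -
    have "(\<Sum>i\<in>tuples (Suc k). of_bool (window k xs t = i) * f i) = (\<Sum>i\<in>{window k xs t}. of_bool (window k xs t = i) * f i)"
      using window_in_tuples[OF assms that] by (intro sum.mono_neutral_right) auto
    then show ?thesis by simp
  qed
  moreover have "(\<Sum>i\<in>tuples (Suc k). empirical k xs i * f i)
      = (\<Sum>t<length xs. \<Sum>i\<in>tuples (Suc k). of_bool (window k xs t = i) * f i) / real (length xs)"
    unfolding empirical_eq_window
    by (subst sum.swap) (simp add: sum_distrib_right sum_divide_distrib)
  ultimately show ?thesis by simp
qed

lemma prob_dist_empirical:
  assumes "k \<le> length xs" "xs \<noteq> []"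
  shows "prob_dist (Suc k) (empirical k xs)"
  unfolding prob_dist_def
proof (intro conjI ballI allI impI)
  show "(\<Sum>i\<in>tuples (Suc k). empirical k xs i) = 1"
    using sum_empirical[OF assms(1), of "\<lambda>_. 1"] assms(2) by simp
  show "empirical k xs i = 0" if "i \<notin> tuples (Suc k)" for i
  proof -
    have "window k xs t \<noteq> i" if "t < length xs" for t
      using window_in_tuples[OF assms(1) that] \<open>i \<notin> tuples (Suc k)\<close> by auto
    then show ?thesis
      by (auto simp: empirical_eq_window intro!: sum.neutral)
  qed
qed (simp add: empirical_eq_window sum_nonneg)

text \<open>The first \<open>Suc k\<close> letters from a start inside the path reach at most
  \<open>k\<close> letters into the appended part, so the longer augmentation makes no difference to
  them.\<close>

lemma take_window:
  assumes "k < length xs" "t < length xs"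
  shows "take (Suc k) (window (Suc k) xs t) = window k xs t"
proof -
  have "Suc k + t - length xs \<le> k" "Suc (Suc k) + t - length xs \<le> Suc k"
    using assms by auto
  then show ?thesis using assms by (simp add: window_def min_def)
qed

text \<open>Dropping the first letter advances the start by one; from the last start it leaves the
  appended copy of the beginning of the path, which is read as the window at 0. This wrap-around
  makes empirical measures exactly, not just approximately, stationary.\<close>

lemma tl_window:
  assumes "k < length xs" "t < length xs"
  shows "tl (window (Suc k) xs t) = window k xs (Suc t mod length xs)"
proof (cases "Suc t = length xs")
  case True
  then have "Suc (Suc (k + t)) - length xs = Suc k" by simp
  then show ?thesis using assms True
    by (simp add: window_def tl_take tl_drop flip: drop_Suc)
next
  case False
  then have "Suc t < length xs" "Suc (Suc (k + t)) - length xs \<le> k"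
    using assms by auto
  then show ?thesis using assms
    by (simp add: window_def tl_take tl_drop min_def flip: drop_Suc)
qed

lemma sum_of_bool_snoc:
  assumes "length w = Suc (Suc k)" "length i = Suc k"
  shows "(\<Sum>j\<in>UNIV. of_bool (w = i @ [j :: 'a::finite]) :: real) = of_bool (take (Suc k) w = i)"
proof -
  have "w = i @ [j] \<longleftrightarrow> take (Suc k) w = i \<and> j = last w" for j
    using assms by (metis append_butlast_last_id append_eq_conv_conj butlast_conv_take
        butlast_snoc diff_Suc_1 last_snoc length_0_conv nat.distinct(1))
  then show ?thesis
    by (simp add: of_bool_conj flip: sum_distrib_left)
qed

lemma sum_of_bool_Cons:
  assumes "length w = Suc (Suc k)"
  shows "(\<Sum>j\<in>UNIV. of_bool (w = (j :: 'a::finite) # i) :: real) = of_bool (tl w = i)"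
proof -
  have "w = j # i \<longleftrightarrow> tl w = i \<and> j = hd w" for j
    using assms by (cases w) auto
  then show ?thesis
    by (simp add: of_bool_conj flip: sum_distrib_left)
qed

lemma sum_empirical_snoc:
  assumes "k < length xs" "i \<in> tuples (Suc k)"
  shows "(\<Sum>j\<in>UNIV. empirical (Suc k) xs (i @ [j])) = empirical k xs i"
proof -
  have "(\<Sum>j\<in>UNIV. of_bool (window (Suc k) xs t = i @ [j]) :: real) = of_bool (window k xs t = i)"
    if "t < length xs" for t
    using sum_of_bool_snoc[of "window (Suc k) xs t" k i] window_in_tuples[of "Suc k" xs t] assms that
    by (simp add: tuples_def take_window)
  then show ?thesis
    unfolding empirical_eq_window sum_divide_distrib[symmetric] by (subst sum.swap) simp
qed

lemma sum_empirical_Cons: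
  assumes "k < length xs" "i \<in> tuples (Suc k)"
  shows "(\<Sum>j\<in>UNIV. empirical (Suc k) xs (j # i)) = empirical k xs i"
proof -
  have "(\<Sum>j\<in>UNIV. of_bool (window (Suc k) xs t = j # i) :: real)
      = of_bool (window k xs (Suc t mod length xs) = i)" if "t < length xs" for t
    using sum_of_bool_Cons[of "window (Suc k) xs t" k i] window_in_tuples[of "Suc k" xs t] assms that
    by (simp add: tuples_def tl_window)
  then have "(\<Sum>j\<in>UNIV. empirical (Suc k) xs (j # i))
      = (\<Sum>t<length xs. of_bool (window k xs (Suc t mod length xs) = i)) / real (length xs)"
    unfolding empirical_eq_window sum_divide_distrib[symmetric] by (subst sum.swap) simp
  \<comment> \<open>The successor modulo the length permutes the start positions.\<close>
  also have "(\<Sum>t<length xs. of_bool (window k xs (Suc t mod length xs) = i) :: real)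
      = (\<Sum>t<length xs. of_bool (window k xs t = i))"
  proof -
    obtain l where l: "length xs = Suc l"
      using assms by (cases "length xs") auto
    have "(\<Sum>t<Suc l. of_bool (window k xs (Suc t mod Suc l) = i) :: real)
        = (\<Sum>t<l. of_bool (window k xs (Suc t) = i)) + of_bool (window k xs 0 = i)"
      by simp
    also have "\<dots> = (\<Sum>t<Suc l. of_bool (window k xs t = i))"
      by (subst sum.lessThan_Suc_shift) simp
    finally show ?thesis by (simp only: l)
  qed
  finally show ?thesis by (simp only: empirical_eq_window)
qed

lemma reduced_dist_empirical:
  assumes "Suc k \<le> length xs"
  shows "reduced_dist (empirical (Suc k) xs) = empirical k xs"
proof
  fix i
  have ne: "xs \<noteq> []" using assms by auto
  show "reduced_dist (empirical (Suc k) xs) i = empirical k xs i"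
  proof (cases "i \<in> tuples (Suc k)")
    case True
    then show ?thesis using assms by (simp add: reduced_dist_def sum_empirical_snoc)
  next
    case False
    then show ?thesis
      using prob_dist_empirical[OF _ ne, of k] prob_dist_reduced[OF prob_dist_empirical[OF assms ne]] assms
      by (simp add: prob_dist_def)
  qed
qed

text \<open>Summing out either the first or the last letter of the order \<open>Suc k\<close>
  measure gives the order \<open>k\<close> measure of the same path, so the recursive condition
  follows by induction on the order.\<close>

lemma stationary_empirical:
  assumes "k \<le> length xs" "xs \<noteq> []"
  shows "stationary (Suc k) (empirical k xs)"
  using assms(1)
proof (induction k)
  case 0
  then show ?case using prob_dist_empirical[OF _ assms(2)] by (simp only: stationary_1_iff)
next
  case (Suc k)
  then show ?case
    using prob_dist_empirical[OF Suc.prems assms(2)]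
    by (subst stationary.simps)
       (simp add: reduced_dist_empirical sum_empirical_snoc sum_empirical_Cons del: stationary.simps)
qed

text \<open>For a transition function \<open>q\<close> this is the probability of the path given its
  first \<open>s\<close> letters. Only windows inside the path count, without wrap-around, so a path
  of length at most \<open>s\<close> has product 1.\<close>

definition path_prod :: "nat \<Rightarrow> ('a list \<Rightarrow> real) \<Rightarrow> 'a list \<Rightarrow> real" where
  "path_prod s q xs = (\<Prod>t<length xs - s. q (take (Suc s) (drop t xs)))"

lemma path_prod_snoc:
  assumes "s \<le> length xs"
  shows "path_prod s q (xs @ [a]) = path_prod s q xs * q (drop (length xs - s) xs @ [a])"
proof -
  have "Suc (length xs) - s = Suc (length xs - s)"
    using assms by simp
  then show ?thesis using assms by (simp add: path_prod_def)
qed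

lemma path_prod_nonneg: "(\<And>i. 0 \<le> q i) \<Longrightarrow> 0 \<le> path_prod s q xs"
  by (simp add: path_prod_def prod_nonneg)

text \<open>Each appended letter contributes one factor between \<open>c\<close> and 1. Hence
  closing a path up cyclically by \<open>s\<close> letters changes its product only by a bounded
  factor.\<close>

lemma path_prod_append_bounds:
  assumes "s \<le> length xs" "0 \<le> c" "\<And>i. 0 \<le> q i" "\<And>i. i \<in> tuples (Suc s) \<Longrightarrow> c \<le> q i \<and> q i \<le> 1"
  shows "c ^ length ys * path_prod s q xs \<le> path_prod s q (xs @ ys) \<and> path_prod s q (xs @ ys) \<le> path_prod s q xs"
proof (induction ys rule: rev_induct)
  case (snoc y ys)
  define r where "r = q (drop (length (xs @ ys) - s) (xs @ ys) @ [y])"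
  have r: "c \<le> r" "r \<le> 1"
    using assms(4)[of "drop (length (xs @ ys) - s) (xs @ ys) @ [y]"] assms(1) by (auto simp: r_def tuples_def)
  have step: "path_prod s q (xs @ ys @ [y]) = path_prod s q (xs @ ys) * r"
    using path_prod_snoc[of s "xs @ ys" q y] assms(1) by (simp add: r_def)
  have nn: "0 \<le> path_prod s q (xs @ ys)" by (rule path_prod_nonneg) (rule assms)
  have "c ^ length ys * path_prod s q xs * c \<le> path_prod s q (xs @ ys) * r"
    using snoc r nn assms(2) by (intro mult_mono) auto
  moreover have "path_prod s q (xs @ ys) * r \<le> path_prod s q (xs @ ys)"
    using nn r by (simp add: mult_left_le)
  ultimately show ?case using snoc by (simp add: step mult_ac)
qed simp

text \<open>The windows of the augmented path are the cyclic windows of the path, so the product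
  depends on the empirical measure alone. Positivity is asked only on tuples that occur, so that
  \<open>q\<close> may be the transition function of the empirical measure itself.\<close>

lemma path_prod_cyclic:
  fixes xs :: "'a::finite list"
  assumes "s \<le> length xs" "xs \<noteq> []" "\<And>i. i \<in> tuples (Suc s) \<Longrightarrow> empirical s xs i > 0 \<Longrightarrow> q i > 0"
  shows "path_prod s q (xs @ take s xs) = exp (real (length xs) * (\<Sum>i\<in>tuples (Suc s). empirical s xs i * ln (q i)))"
proof -
  have q: "q (window s xs t) > 0" if "t < length xs" for t
  proof (rule assms(3))
    show "window s xs t \<in> tuples (Suc s)" using window_in_tuples assms(1) that by blast
    have "(0::real) < (\<Sum>r<length xs. of_bool (window s xs r = window s xs t))"
      by (rule sum_pos2[of _ t]) (use that in auto)
    then show "empirical s xs (window s xs t) > 0"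
      using assms(2) by (simp add: empirical_eq_window)
  qed
  have "path_prod s q (xs @ take s xs) = (\<Prod>t<length xs. q (window s xs t))"
    using assms(1) by (simp add: path_prod_def window_def min_def)
  also have "\<dots> = exp (\<Sum>t<length xs. ln (q (window s xs t)))"
    using q by (simp add: exp_sum)
  finally show ?thesis
    using assms(2) by (simp add: sum_empirical[OF assms(1)])
qed

section \<open>Total mass of path products\<close>

lemma sum_path_Suc:
  fixes q :: "'a::finite list \<Rightarrow> real"
  assumes "s \<le> l"
  shows "(\<Sum>x\<in>tuples (Suc l). f (take s x) * path_prod s q x) =
    (\<Sum>x\<in>tuples l. f (take s x) * path_prod s q x * (\<Sum>a\<in>UNIV. q (drop (l - s) x @ [a])))"
  unfolding sum_tuples_Suc sum_distrib_left
  using assms by (intro sum.cong) (simp_all add: tuples_def path_prod_snoc)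

text \<open>Summing out the last letter gives a factor 1 at each step, until only the initial tuple
  is left.\<close>

lemma sum_path_eq:
  fixes q :: "'a::finite list \<Rightarrow> real"
  assumes "s \<le> l" and q: "\<And>u. u \<in> tuples s \<Longrightarrow> (\<Sum>a\<in>UNIV. q (u @ [a])) = 1"
  shows "(\<Sum>x\<in>tuples l. f (take s x) * path_prod s q x) = (\<Sum>u\<in>tuples s. f u)"
  using assms(1)
proof (induction l rule: dec_induct)
  case base
  show ?case by (rule sum.cong) (auto simp: tuples_def path_prod_def)
next
  case (step l)
  have "(\<Sum>a\<in>UNIV. q (drop (l - s) x @ [a])) = 1" if "x \<in> tuples l" for x
    using q[of "drop (l - s) x"] that step by (simp add: tuples_def)
  then show ?case using step by (simp add: sum_path_Suc)
qed

lemma sum_path_le: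
  fixes q :: "'a::finite list \<Rightarrow> real"
  assumes "s \<le> l" and q: "\<And>u. u \<in> tuples s \<Longrightarrow> (\<Sum>a\<in>UNIV. q (u @ [a])) \<le> 1"
    and nn: "\<And>i. 0 \<le> q i"
  shows "(\<Sum>x\<in>tuples l. path_prod s q x) \<le> real (card (tuples s :: 'a list set))"
  using assms(1)
proof (induction l rule: dec_induct)
  case base
  have "path_prod s q x = 1" if "x \<in> tuples s" for x
    using that by (auto simp: tuples_def path_prod_def)
  then show ?case by simp
next
  case (step l)
  have "(\<Sum>x\<in>tuples (Suc l). path_prod s q x)
     = (\<Sum>x\<in>tuples l. path_prod s q x * (\<Sum>a\<in>UNIV. q (drop (l - s) x @ [a])))"
    using sum_path_Suc[OF step(1), of "\<lambda>_. 1" q] by simp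
  also have "\<dots> \<le> (\<Sum>x\<in>tuples l. path_prod s q x)"
    using q step(1) by (intro sum_mono mult_left_le path_prod_nonneg nn) (auto simp: tuples_def)
  finally show ?case using step by simp
qed

subsection \<open>Conditional relative entropy\<close>

text \<open>The conditional probability of the last letter given the preceding ones. At a context of
  mass 0, division by zero gives the value 0, so that this row sums to 0 instead of 1.\<close>

definition transition :: "('a::finite list \<Rightarrow> real) \<Rightarrow> 'a list \<Rightarrow> real" where
  "transition \<nu> i = \<nu> i / reduced_dist \<nu> (butlast i)"

lemma prob_dist_nonneg: "prob_dist k \<nu> \<Longrightarrow> 0 \<le> \<nu> i"
  by (cases "i \<in> tuples k") (auto simp: prob_dist_def)

lemma le_reduced_dist:
  assumes "prob_dist (Suc s) \<nu>" "i \<in> tuples (Suc s)"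
  shows "\<nu> i \<le> reduced_dist \<nu> (butlast i)"
proof -
  have "i = butlast i @ [last i]"
    using assms(2) by (intro append_butlast_last_id[symmetric]) (auto simp: tuples_def)
  then have "\<nu> i = \<nu> (butlast i @ [last i])" by simp
  also have "\<dots> \<le> (\<Sum>j\<in>UNIV. \<nu> (butlast i @ [j]))"
    by (rule member_le_sum[of "last i" UNIV "\<lambda>j. \<nu> (butlast i @ [j])"]) (auto intro: prob_dist_nonneg assms)
  finally show ?thesis by (simp add: reduced_dist_def)
qed

lemma transition_nonneg: "prob_dist (Suc s) \<nu> \<Longrightarrow> 0 \<le> transition \<nu> i"
  by (metis divide_nonneg_nonneg prob_dist_nonneg prob_dist_reduced transition_def)

lemma transition_le_1:
  assumes "prob_dist (Suc s) \<nu>" "i \<in> tuples (Suc s)"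
  shows "transition \<nu> i \<le> 1"
  using le_reduced_dist[OF assms] prob_dist_nonneg[OF assms(1), of i]
  by (auto simp: transition_def divide_le_eq_1)

lemma transition_pos:
  assumes "prob_dist (Suc s) \<nu>" "i \<in> tuples (Suc s)" "0 < \<nu> i"
  shows "0 < transition \<nu> i"
  using le_reduced_dist[OF assms(1,2)] assms(3) by (simp add: transition_def)

lemma sum_transition:
  "(\<Sum>a\<in>UNIV. transition \<nu> (u @ [a])) = (if reduced_dist \<nu> u = 0 then 0 else 1)"
  by (simp add: transition_def reduced_dist_def flip: sum_divide_distrib)

lemma reduced_dist_pos:
  fixes u :: "'a::finite list"
  assumes "\<And>i. i \<in> tuples (Suc s) \<Longrightarrow> 0 < \<nu> i" "u \<in> tuples s"
  shows "0 < reduced_dist \<nu> u"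
  unfolding reduced_dist_def using assms by (intro sum_pos) (auto simp: tuples_def)

text \<open>Where the marginal vanishes so does the entry, so the identity survives division by
  zero.\<close>

lemma reduced_dist_transition:
  assumes "prob_dist (Suc s) \<nu>" "i \<in> tuples (Suc s)"
  shows "reduced_dist \<nu> (butlast i) * transition \<nu> i = \<nu> i"
  using le_reduced_dist[OF assms] prob_dist_nonneg[OF assms(1), of i] by (auto simp: transition_def)

text \<open>Expands the marginal over the last letter; this merges entropies of
  \<open>s\<close>-tuples with those of \<open>(s+1)\<close>-tuples.\<close>

lemma sum_reduced_dist_mult:
  "(\<Sum>u\<in>tuples s. reduced_dist \<nu> u * f u) = (\<Sum>i\<in>tuples (Suc s). \<nu> i * f (butlast i))"
  by (simp add: sum_tuples_Suc reduced_dist_def sum_distrib_right)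

text \<open>The logarithms are kept apart so that continuity in \<open>\<nu>\<close> is evident.\<close>

definition cond_entropy :: "nat \<Rightarrow> ('a::finite list \<Rightarrow> real) \<Rightarrow> ('a list \<Rightarrow> real) \<Rightarrow> real" where
  "cond_entropy s \<nu> \<kappa> = (\<Sum>i\<in>tuples (Suc s). \<nu> i * ln (\<nu> i))
     - (\<Sum>u\<in>tuples s. reduced_dist \<nu> u * ln (reduced_dist \<nu> u))
     - (\<Sum>i\<in>tuples (Suc s). \<nu> i * ln (transition \<kappa> i))"

text \<open>Where \<open>\<nu> i\<close> is positive its marginal is too, and the logarithm of the
  quotient splits; where it is 0 all terms vanish. The entropy becomes the
  \<open>\<nu>\<close>-average of a log-likelihood ratio of transitions.\<close>

lemma cond_entropy_eq:
  assumes "prob_dist (Suc s) \<nu>"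
  shows "cond_entropy s \<nu> \<kappa> = (\<Sum>i\<in>tuples (Suc s). \<nu> i * (ln (transition \<nu> i) - ln (transition \<kappa> i)))"
proof -
  have "\<nu> i * ln (\<nu> i) - \<nu> i * ln (reduced_dist \<nu> (butlast i)) = \<nu> i * ln (transition \<nu> i)"
    if "i \<in> tuples (Suc s)" for i
  proof (cases "\<nu> i = 0")
    case False
    then have "0 < \<nu> i" using prob_dist_nonneg[OF assms, of i] by simp
    then show ?thesis using le_reduced_dist[OF assms that]
      by (simp add: transition_def ln_div algebra_simps)
  qed simp
  then show ?thesis
    unfolding cond_entropy_def sum_reduced_dist_mult sum_subtractf[symmetric]
    by (intro sum.cong) (simp_all add: algebra_simps)
qed

text \<open>Since \<open>\<mu>\<close> and its marginal are positive, no term of either relative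
  entropy is infinite, and the \<open>ereal\<close> difference is one of real numbers.\<close>

lemma cond_rel_entropy_eq:
  fixes \<mu> :: "'a::finite list \<Rightarrow> real"
  assumes "prob_dist (Suc s) \<nu>" and pos: "\<And>i. i \<in> tuples (Suc s) \<Longrightarrow> 0 < \<mu> i"
  shows "cond_rel_entropy s \<nu> \<mu> = ereal (cond_entropy s \<nu> \<mu>)"
proof -
  have rel: "rel_entropy k \<nu>' \<mu>' = ereal (\<Sum>i\<in>tuples k. \<nu>' i * ln (\<nu>' i / \<mu>' i))"
    if "\<And>i. i \<in> tuples k \<Longrightarrow> 0 < \<mu>' i" for k and \<nu>' \<mu>' :: "'a list \<Rightarrow> real"
    unfolding rel_entropy_def sum_ereal[symmetric] using that by (intro sum.cong) (auto dest: that)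
  have rpos: "0 < reduced_dist \<mu> u" if "u \<in> tuples s" for u
    using reduced_dist_pos[OF pos that] by simp
  have "cond_rel_entropy s \<nu> \<mu> = ereal ((\<Sum>i\<in>tuples (Suc s). \<nu> i * ln (\<nu> i / \<mu> i))
      - (\<Sum>u\<in>tuples s. reduced_dist \<nu> u * ln (reduced_dist \<nu> u / reduced_dist \<mu> u)))"
    by (simp add: cond_rel_entropy_def rel pos rpos)
  also have "(\<Sum>i\<in>tuples (Suc s). \<nu> i * ln (\<nu> i / \<mu> i))
      - (\<Sum>u\<in>tuples s. reduced_dist \<nu> u * ln (reduced_dist \<nu> u / reduced_dist \<mu> u))
      = (\<Sum>i\<in>tuples (Suc s). \<nu> i * ln (\<nu> i / \<mu> i)
          - \<nu> i * ln (reduced_dist \<nu> (butlast i) / reduced_dist \<mu> (butlast i)))"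
    by (simp add: sum_reduced_dist_mult sum_subtractf)
  also have "\<dots> = (\<Sum>i\<in>tuples (Suc s). \<nu> i * (ln (transition \<nu> i) - ln (transition \<mu> i)))"
  proof (rule sum.cong[OF refl])
    fix i :: "'a list" assume i: "i \<in> tuples (Suc s)"
    then have m: "0 < \<mu> i" "0 < reduced_dist \<mu> (butlast i)"
      using pos rpos[of "butlast i"] by (auto simp: tuples_def)
    show "\<nu> i * ln (\<nu> i / \<mu> i) - \<nu> i * ln (reduced_dist \<nu> (butlast i) / reduced_dist \<mu> (butlast i))
        = \<nu> i * (ln (transition \<nu> i) - ln (transition \<mu> i))"
    proof (cases "\<nu> i = 0")
      case False
      then have "0 < \<nu> i" using prob_dist_nonneg[OF assms(1), of i] by simp
      then show ?thesis using le_reduced_dist[OF assms(1) i] m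
        by (simp add: transition_def ln_div algebra_simps)
    qed simp
  qed
  finally show ?thesis by (simp add: cond_entropy_eq[OF assms(1)])
qed

text \<open>This is \<open>ln z \<le> z - 1\<close> at \<open>z = b * c / a\<close>, with equality
  only for \<open>z = 1\<close>. Below, \<open>a\<close> is an entry of \<open>\<nu>\<close>,
  \<open>b\<close> its marginal and \<open>c\<close> a transition of
  \<open>\<kappa>\<close>.\<close>

lemma mult_ln_diff_ge:
  fixes a b c :: real
  assumes "0 \<le> a" "a \<le> b" "0 < c"
  shows "a - b * c \<le> a * (ln (a / b) - ln c)"
    and "a * (ln (a / b) - ln c) = a - b * c \<Longrightarrow> a = b * c"
proof -
  have *: "a - b * c \<le> a * (ln (a / b) - ln c) \<and> (a * (ln (a / b) - ln c) = a - b * c \<longrightarrow> a = b * c)"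
  proof (cases "a = 0")
    case True then show ?thesis using assms by auto
  next
    case False
    then have p: "0 < a" "0 < b" using assms by auto
    define z where "z = b * c / a"
    have z: "0 < z" using p assms by (simp add: z_def)
    have "a * (ln (a / b) - ln c) = - a * ln z"
      using p assms(3) by (simp add: z_def ln_div ln_mult algebra_simps)
    moreover have "a - b * c = - a * (z - 1)"
      using p by (simp add: z_def algebra_simps)
    ultimately show ?thesis
      using ln_le_minus_one[OF z] ln_eq_minus_one[OF z] p by (auto simp: z_def)
  qed
  then show "a - b * c \<le> a * (ln (a / b) - ln c)" "a * (ln (a / b) - ln c) = a - b * c \<Longrightarrow> a = b * c"
    by auto
qed

text \<open>Both \<open>\<nu>\<close> and the vector with the marginal of \<open>\<nu>\<close> and
  the transitions of \<open>\<kappa>\<close> have mass 1. So the termwise lower bounds for the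
  entropy add up to 0.\<close>

lemma sum_reduced_transition:
  assumes "prob_dist (Suc s) \<nu>" and pos: "\<And>i. i \<in> tuples (Suc s) \<Longrightarrow> 0 < \<kappa> i"
  shows "(\<Sum>i\<in>tuples (Suc s). \<nu> i - reduced_dist \<nu> (butlast i) * transition \<kappa> i) = 0"
proof -
  have "(\<Sum>i\<in>tuples (Suc s). reduced_dist \<nu> (butlast i) * transition \<kappa> i)
      = (\<Sum>u\<in>tuples s. reduced_dist \<nu> u * (\<Sum>a\<in>UNIV. transition \<kappa> (u @ [a])))"
    by (simp add: sum_tuples_Suc sum_distrib_left)
  also have "\<dots> = (\<Sum>u\<in>tuples s. reduced_dist \<nu> u)"
    using reduced_dist_pos[of s \<kappa>, OF pos] by (intro sum.cong) (auto simp: sum_transition less_le)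
  also have "\<dots> = 1" using prob_dist_reduced[OF assms(1)] by (simp add: prob_dist_def)
  finally show ?thesis using assms(1) by (simp add: sum_subtractf prob_dist_def)
qed

lemma cond_entropy_nonneg:
  assumes "prob_dist (Suc s) \<nu>" "prob_dist (Suc s) \<kappa>" and pos: "\<And>i. i \<in> tuples (Suc s) \<Longrightarrow> 0 < \<kappa> i"
  shows "0 \<le> cond_entropy s \<nu> \<kappa>"
proof -
  have "(\<Sum>i\<in>tuples (Suc s). \<nu> i - reduced_dist \<nu> (butlast i) * transition \<kappa> i) \<le> cond_entropy s \<nu> \<kappa>"
    unfolding cond_entropy_eq[OF assms(1)] transition_def[of \<nu>]
    by (intro sum_mono mult_ln_diff_ge(1)) (auto intro: prob_dist_nonneg le_reduced_dist transition_pos assms)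
  then show ?thesis by (simp add: sum_reduced_transition[OF assms(1) pos])
qed

text \<open>The gaps \<open>g\<close> in the termwise bounds are nonnegative and sum to 0, so each
  vanishes, and the equality case says that \<open>\<nu>\<close> has the transitions of
  \<open>\<kappa>\<close>.\<close>

lemma cond_entropy_eq_0D:
  assumes "prob_dist (Suc s) \<nu>" "prob_dist (Suc s) \<kappa>" and pos: "\<And>i. i \<in> tuples (Suc s) \<Longrightarrow> 0 < \<kappa> i"
    and "cond_entropy s \<nu> \<kappa> = 0" and i: "i \<in> tuples (Suc s)"
  shows "\<nu> i = reduced_dist \<nu> (butlast i) * transition \<kappa> i"
proof -
  define g where "g i = \<nu> i * (ln (transition \<nu> i) - ln (transition \<kappa> i))
      - (\<nu> i - reduced_dist \<nu> (butlast i) * transition \<kappa> i)" for i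
  have "0 \<le> g i" if "i \<in> tuples (Suc s)" for i
    using mult_ln_diff_ge(1)[of "\<nu> i" "reduced_dist \<nu> (butlast i)" "transition \<kappa> i", folded transition_def] that
    by (auto simp: g_def intro: prob_dist_nonneg le_reduced_dist transition_pos assms)
  moreover have "(\<Sum>i\<in>tuples (Suc s). g i) = 0"
    using assms(4) sum_reduced_transition[OF assms(1) pos]
    by (simp only: g_def sum_subtractf[of "\<lambda>i. \<nu> i * _ i"] cond_entropy_eq[OF assms(1)])
  ultimately have "g i = 0"
    using i by (simp add: sum_nonneg_eq_0_iff)
  then show ?thesis
    using mult_ln_diff_ge(2)[of "\<nu> i" "reduced_dist \<nu> (butlast i)" "transition \<kappa> i", folded transition_def] i
    by (auto simp: g_def intro: prob_dist_nonneg le_reduced_dist transition_pos assms)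
qed

text \<open>Subtracting the largest multiple of \<open>\<kappa>\<close> below \<open>\<nu>\<close> on \<open>s\<close>-tuples leaves an invariant
  nonnegative vector with a zero; as all transitions are positive, zeros propagate backwards
  to every \<open>s\<close>-tuple.\<close>

lemma stationary_unique:
  fixes \<nu> \<kappa> :: "'a::finite list \<Rightarrow> real"
  assumes nu: "stationary (Suc s) \<nu>" and ka: "stationary (Suc s) \<kappa>"
    and pos: "\<And>i. i \<in> tuples (Suc s) \<Longrightarrow> 0 < \<kappa> i"
    and trans: "\<And>i. i \<in> tuples (Suc s) \<Longrightarrow> \<nu> i = reduced_dist \<nu> (butlast i) * transition \<kappa> i"
  shows "\<nu> = \<kappa>"
proof -
  note pd = nu[THEN stationary_imp_prob_dist] ka[THEN stationary_imp_prob_dist]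
  have rpos: "0 < reduced_dist \<kappa> u" if "u \<in> tuples s" for u
    using reduced_dist_pos[OF pos that] by simp
  define r where "r u = reduced_dist \<nu> u / reduced_dist \<kappa> u" for u
  define m where "m = Min (r ` tuples s)"
  have ne: "tuples s \<noteq> ({} :: 'a list set)"
    using Ex_list_of_length[of s] by (auto simp: tuples_def)
  then have "m \<in> r ` tuples s"
    unfolding m_def by (intro Min_in) auto
  then obtain u0 where u0: "u0 \<in> tuples s" "m = r u0" by auto
  define \<delta> where "\<delta> u = reduced_dist \<nu> u - m * reduced_dist \<kappa> u" for u
  have \<delta>_nonneg: "0 \<le> \<delta> u" if "u \<in> tuples s" for u
  proof -
    have "m \<le> r u" unfolding m_def using that by (intro Min_le) auto
    then show ?thesis using rpos[OF that] by (simp add: \<delta>_def r_def le_divide_eq)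
  qed
  have \<delta>_u0: "\<delta> u0 = 0"
    using rpos[OF u0(1)] u0(2) by (simp add: \<delta>_def r_def)
  \<comment> \<open>Stationarity lets the summed letter stand in front; the tuple
    \<open>a # i\<close> is then split into its context \<open>butlast (a # i)\<close> and its last
    letter.\<close>
  have invariant: "\<delta> i = (\<Sum>a\<in>UNIV. \<delta> (butlast (a # i)) * transition \<kappa> (a # i))" if "i \<in> tuples s" for i
  proof -
    have "reduced_dist \<nu> i = (\<Sum>a\<in>UNIV. reduced_dist \<nu> (butlast (a # i)) * transition \<kappa> (a # i))"
      using nu that trans[symmetric] by (simp add: reduced_dist_def[of \<nu> i] tuples_def del: butlast.simps)
    moreover have "reduced_dist \<kappa> i = (\<Sum>a\<in>UNIV. reduced_dist \<kappa> (butlast (a # i)) * transition \<kappa> (a # i))"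
      using ka that reduced_dist_transition[OF pd(2)] by (simp add: reduced_dist_def[of \<kappa> i] tuples_def del: butlast.simps)
    ultimately show ?thesis
      by (simp add: \<delta>_def sum_subtractf sum_distrib_left algebra_simps del: butlast.simps)
  qed
  have propagate: "\<delta> (butlast (a # i)) = 0" if "i \<in> tuples s" "\<delta> i = 0" for a i
  proof -
    have t: "0 < transition \<kappa> (a # i)" for a
      using that by (intro transition_pos[OF pd(2)] pos) (auto simp: tuples_def)
    have "(\<Sum>a\<in>UNIV. \<delta> (butlast (a # i)) * transition \<kappa> (a # i)) = 0"
      using invariant[OF that(1)] that(2) by simp
    moreover have "0 \<le> \<delta> (butlast (a # i)) * transition \<kappa> (a # i)" for a
      using that t[of a] by (intro mult_nonneg_nonneg \<delta>_nonneg) (auto simp: tuples_def)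
    ultimately have "\<delta> (butlast (a # i)) * transition \<kappa> (a # i) = 0"
      by (simp add: sum_nonneg_eq_0_iff del: butlast.simps)
    then show ?thesis using t[of a] by simp
  qed
  \<comment> \<open>Each letter of \<open>w\<close> put in front pushes one letter of
    \<open>u0\<close> out at the end. At full length \<open>w\<close> is an arbitrary
    \<open>s\<close>-tuple and nothing of \<open>u0\<close> is left.\<close>
  have zero: "\<delta> (w @ take (s - length w) u0) = 0" if "length w \<le> s" for w
    using that
  proof (induction w)
    case Nil
    then show ?case using u0(1) \<delta>_u0 by (simp add: tuples_def)
  next
    case (Cons a w)
    have "butlast (a # w @ take (s - length w) u0) = (a # w) @ take (s - length (a # w)) u0"
      using Cons.prems u0(1) by (auto simp: butlast_append tuples_def butlast_take)
    then show ?case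
      using propagate[of "w @ take (s - length w) u0" a] Cons u0(1) by (simp add: tuples_def del: butlast.simps)
  qed
  have red: "reduced_dist \<nu> u = m * reduced_dist \<kappa> u" if "u \<in> tuples s" for u
    using zero[of u] that by (simp add: tuples_def \<delta>_def)
  then have "(\<Sum>u\<in>tuples s. reduced_dist \<nu> u) = m * (\<Sum>u\<in>tuples s. reduced_dist \<kappa> u)"
    by (simp add: sum_distrib_left)
  then have "m = 1"
    using pd[THEN prob_dist_reduced] by (simp add: prob_dist_def)
  show ?thesis
  proof
    fix i
    show "\<nu> i = \<kappa> i"
    proof (cases "i \<in> tuples (Suc s)")
      case True
      then have "butlast i \<in> tuples s" by (simp add: tuples_def)
      then show ?thesis
        using trans[OF True] reduced_dist_transition[OF pd(2) True] red \<open>m = 1\<close> by simp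
    next
      case False
      then show ?thesis using pd by (simp add: prob_dist_def)
    qed
  qed
qed

subsection \<open>Weights of type classes\<close>

text \<open>The law of the order \<open>s\<close> chain with tuple distribution
  \<open>\<kappa>\<close>, defined without a probability space so that it serves
  \<open>\<mu>\<close> and the changed measures alike. \<open>prob_block_eq_path_weight\<close>
  links it to the process.\<close>

definition path_weight :: "nat \<Rightarrow> ('a::finite list \<Rightarrow> real) \<Rightarrow> 'a list \<Rightarrow> real" where
  "path_weight s \<kappa> x = reduced_dist \<kappa> (take s x) * path_prod s (transition \<kappa>) x"

lemma path_weight_nonneg: "prob_dist (Suc s) \<kappa> \<Longrightarrow> 0 \<le> path_weight s \<kappa> x"
  by (simp add: path_weight_def path_prod_nonneg prob_dist_nonneg[OF prob_dist_reduced] transition_nonneg)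

lemma sum_path_weight:
  assumes "prob_dist (Suc s) \<kappa>" "\<And>i. i \<in> tuples (Suc s) \<Longrightarrow> 0 < \<kappa> i" "s \<le> l"
  shows "(\<Sum>x\<in>tuples l. path_weight s \<kappa> x) = 1"
proof -
  have "(\<Sum>a\<in>UNIV. transition \<kappa> (u @ [a])) = 1" if "u \<in> tuples s" for u
    using reduced_dist_pos[of s \<kappa>, OF assms(2) that] by (simp add: sum_transition)
  then show ?thesis
    using prob_dist_reduced[OF assms(1)] by (simp add: path_weight_def sum_path_eq assms(3) prob_dist_def)
qed

text \<open>The weight differs from the cyclic product by the initial marginal and by
  \<open>s\<close> closing factors, all bounded away from 0 by positivity. So it is a function of
  the empirical measure up to a constant independent of the length.\<close>

lemma path_weight_bounds:
  fixes \<kappa> :: "'a::finite list \<Rightarrow> real"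
  assumes "prob_dist (Suc s) \<kappa>" and pos: "\<And>i. i \<in> tuples (Suc s) \<Longrightarrow> 0 < \<kappa> i"
  obtains c where "0 < c"
    "\<And>x. s \<le> length x \<Longrightarrow> x \<noteq> [] \<Longrightarrow>
      c * exp (real (length x) * (\<Sum>i\<in>tuples (Suc s). empirical s x i * ln (transition \<kappa> i))) \<le> path_weight s \<kappa> x"
    "\<And>x. s \<le> length x \<Longrightarrow> x \<noteq> [] \<Longrightarrow>
      path_weight s \<kappa> x \<le> exp (real (length x) * (\<Sum>i\<in>tuples (Suc s). empirical s x i * ln (transition \<kappa> i))) / c"
proof -
  have ne: "tuples k \<noteq> ({} :: 'a list set)" for k
    using Ex_list_of_length[of k] by (auto simp: tuples_def)
  define c where "c = Min (transition \<kappa> ` tuples (Suc s))"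
  define d where "d = Min (reduced_dist \<kappa> ` tuples s)"
  have c: "0 < c" unfolding c_def using ne
    by (subst Min_gr_iff) (auto intro: transition_pos assms)
  have d: "0 < d" unfolding d_def using ne
    by (subst Min_gr_iff) (auto intro: reduced_dist_pos assms)
  have trans: "c \<le> transition \<kappa> i \<and> transition \<kappa> i \<le> 1" if "i \<in> tuples (Suc s)" for i
    unfolding c_def using that transition_le_1[OF assms(1) that] by (auto intro: Min_le)
  have red: "d \<le> reduced_dist \<kappa> u \<and> reduced_dist \<kappa> u \<le> 1" if "u \<in> tuples s" for u
  proof
    show "d \<le> reduced_dist \<kappa> u" unfolding d_def using that by (auto intro: Min_le)
    have "reduced_dist \<kappa> u \<le> (\<Sum>u\<in>tuples s. reduced_dist \<kappa> u)"
      using that prob_dist_nonneg[OF prob_dist_reduced[OF assms(1)]] by (intro member_le_sum) auto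
    then show "reduced_dist \<kappa> u \<le> 1"
      using prob_dist_reduced[OF assms(1)] by (simp add: prob_dist_def)
  qed
  \<comment> \<open>The bound \<open>d\<close> pays for the initial marginal in the first
    inequality, and \<open>c ^ s\<close> for the closing letters in the second.\<close>
  have *: "min d (c ^ s) * path_prod s (transition \<kappa>) (x @ take s x) \<le> path_weight s \<kappa> x
      \<and> min d (c ^ s) * path_weight s \<kappa> x \<le> path_prod s (transition \<kappa>) (x @ take s x)"
    if "s \<le> length x" for x
  proof -
    define P where "P = path_prod s (transition \<kappa>) x"
    define Q where "Q = path_prod s (transition \<kappa>) (x @ take s x)"
    define R where "R = reduced_dist \<kappa> (take s x)"
    have nn: "0 \<le> P" "0 \<le> Q"
      by (auto simp: P_def Q_def intro!: path_prod_nonneg transition_nonneg[OF assms(1)])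
    have PQ: "c ^ s * P \<le> Q" "Q \<le> P"
      using path_prod_append_bounds[OF that, of c "transition \<kappa>" "take s x"] c trans transition_nonneg[OF assms(1)] that
      by (auto simp: P_def Q_def min_absorb2)
    have R: "d \<le> R" "R \<le> 1"
      using red[of "take s x"] that by (auto simp: R_def tuples_def)
    have "min d (c ^ s) * Q \<le> R * P"
      using R PQ nn d by (intro mult_mono) auto
    moreover have "min d (c ^ s) * (R * P) \<le> c ^ s * P"
      using R nn c d by (intro mult_mono) (auto intro: mult_left_le_one_le)
    ultimately show ?thesis
      using PQ by (simp add: path_weight_def P_def[symmetric] Q_def[symmetric] R_def[symmetric])
  qed
  have cyc: "path_prod s (transition \<kappa>) (x @ take s x)
      = exp (real (length x) * (\<Sum>i\<in>tuples (Suc s). empirical s x i * ln (transition \<kappa> i)))"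
    if "s \<le> length x" "x \<noteq> []" for x
    using that by (intro path_prod_cyclic transition_pos[OF assms(1)] pos)
  have pos': "0 < min d (c ^ s)" using c d by simp
  show ?thesis
  proof (rule that[OF pos'])
    fix x :: "'a list" assume x: "s \<le> length x" "x \<noteq> []"
    note bounds = *[OF x(1), unfolded cyc[OF x]]
    then show "min d (c ^ s) * exp (real (length x) * (\<Sum>i\<in>tuples (Suc s). empirical s x i * ln (transition \<kappa> i)))
        \<le> path_weight s \<kappa> x"
      by blast
    show "path_weight s \<kappa> x
        \<le> exp (real (length x) * (\<Sum>i\<in>tuples (Suc s). empirical s x i * ln (transition \<kappa> i))) / min d (c ^ s)"
      using bounds by (subst pos_le_divide_eq[OF pos']) (metis mult.commute)
  qed
qed

text \<open>On the type class of \<open>\<nu>\<close> the summand is the cyclic product of the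
  transitions of \<open>\<nu>\<close> itself times
  \<open>exp (- real l * cond_entropy s \<nu> \<kappa>)\<close>, and \<open>sum_path_le\<close>
  bounds the total of these products. No count of the class is required.\<close>

lemma sum_type_class:
  fixes \<kappa> :: "'a::finite list \<Rightarrow> real"
  assumes "s \<le> l" "0 < l"
  shows "(\<Sum>x | x \<in> tuples l \<and> empirical s x = \<nu>. exp (real l * (\<Sum>i\<in>tuples (Suc s). \<nu> i * ln (transition \<kappa> i))))
    \<le> real (card (tuples s :: 'a list set)) * exp (- real l * cond_entropy s \<nu> \<kappa>)" (is "sum ?g ?A \<le> _")
proof (cases "?A = {}")
  case False
  then obtain x0 where "x0 \<in> tuples l" "empirical s x0 = \<nu>" by blast
  then have pd: "prob_dist (Suc s) \<nu>"
    using prob_dist_empirical[of s x0] assms by (auto simp: tuples_def)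
  have "exp (real l * (\<Sum>i\<in>tuples (Suc s). \<nu> i * ln (transition \<kappa> i)))
      \<le> path_prod s (transition \<nu>) x * exp (- real l * cond_entropy s \<nu> \<kappa>)" if "x \<in> ?A" for x
  proof -
    have x: "length x = l" "x \<noteq> []" "empirical s x = \<nu>" using that assms by (auto simp: tuples_def)
    have "exp (real l * (\<Sum>i\<in>tuples (Suc s). \<nu> i * ln (transition \<kappa> i)))
        = exp (real l * (\<Sum>i\<in>tuples (Suc s). \<nu> i * ln (transition \<nu> i))) * exp (- real l * cond_entropy s \<nu> \<kappa>)"
      by (simp add: cond_entropy_eq[OF pd] sum_subtractf right_diff_distrib flip: exp_add)
    also have "exp (real l * (\<Sum>i\<in>tuples (Suc s). \<nu> i * ln (transition \<nu> i)))
        = path_prod s (transition \<nu>) (x @ take s x)"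
      using path_prod_cyclic[of s x "transition \<nu>"] x assms(1) transition_pos[OF pd] by simp
    \<comment> \<open>Transitions of \<open>\<nu>\<close> may vanish, so the append bound is used
      with lower constant 0.\<close>
    also have "\<dots> \<le> path_prod s (transition \<nu>) x"
      using path_prod_append_bounds[of s x 0 "transition \<nu>" "take s x"] x(1) assms(1)
        transition_nonneg[OF pd] transition_le_1[OF pd] by auto
    finally show ?thesis by simp
  qed
  then have "sum ?g ?A \<le> (\<Sum>x\<in>?A. path_prod s (transition \<nu>) x * exp (- real l * cond_entropy s \<nu> \<kappa>))"
    by (rule sum_mono)
  also have "\<dots> \<le> (\<Sum>x\<in>tuples l. path_prod s (transition \<nu>) x * exp (- real l * cond_entropy s \<nu> \<kappa>))"
    by (rule sum_mono2) (auto intro!: mult_nonneg_nonneg path_prod_nonneg transition_nonneg[OF pd])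
  also have "\<dots> = (\<Sum>x\<in>tuples l. path_prod s (transition \<nu>) x) * exp (- real l * cond_entropy s \<nu> \<kappa>)"
    by (simp add: sum_distrib_right)
  also have "\<dots> \<le> real (card (tuples s :: 'a list set)) * exp (- real l * cond_entropy s \<nu> \<kappa>)"
    using assms(1) by (intro mult_right_mono sum_path_le transition_nonneg[OF pd]) (auto simp: sum_transition)
  finally show ?thesis .
qed (simp only: sum.empty, simp)

text \<open>A type is determined by its counts, one integer between 0 and \<open>l\<close> for each
  \<open>(s+1)\<close>-tuple.\<close>

lemma card_types:
  assumes "s \<le> l" "0 < l"
  shows "card (empirical s ` (tuples l :: 'a::finite list set)) \<le> (l + 1) ^ card (tuples (Suc s) :: 'a list set)"
proof -
  let ?T = "tuples (Suc s) :: 'a list set"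
  let ?F = "?T \<rightarrow>\<^sub>E {..l}"
  let ?h = "\<lambda>c i. if i \<in> ?T then real (c i) / real l else 0"
  have "empirical s x \<in> ?h ` ?F" if "x \<in> tuples l" for x
  proof (rule image_eqI)
    define c where "c i = card {t. t < l \<and> window s x t = i}" for i
    have x: "length x = l" "x \<noteq> []" using that assms by (auto simp: tuples_def)
    have "empirical s x i = real (c i) / real l" for i
      by (simp add: empirical_eq_window x c_def of_bool_def Int_def flip: sum.inter_filter)
    moreover have "empirical s x i = 0" if "i \<notin> ?T" for i
      using prob_dist_empirical[of s x] x assms that by (simp add: prob_dist_def)
    ultimately show "empirical s x = ?h (restrict c ?T)" by (intro ext) auto
    have "c i \<le> l" for i
      using card_mono[of "{..<l}" "{t. t < l \<and> window s x t = i}"] by (auto simp: c_def)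
    then show "restrict c ?T \<in> ?F" by auto
  qed
  then have "card (empirical s ` (tuples l :: 'a list set)) \<le> card (?h ` ?F)"
    by (intro card_mono finite_imageI finite_PiE) auto
  also have "\<dots> \<le> card ?F" by (intro card_image_le finite_PiE) auto
  also have "\<dots> = (l + 1) ^ card ?T" by (simp add: card_PiE)
  finally show ?thesis .
qed

text \<open>Polynomially many types meet \<open>\<Gamma>\<close>, and each has weight at most a
  constant times \<open>exp (- real l * d)\<close>. It serves both for the concentration at
  \<open>\<kappa>\<close> and for the upper bound at \<open>\<mu>\<close>.\<close>

lemma path_weight_upper:
  fixes \<kappa> :: "'a::finite list \<Rightarrow> real"
  assumes "prob_dist (Suc s) \<kappa>" and pos: "\<And>i. i \<in> tuples (Suc s) \<Longrightarrow> 0 < \<kappa> i"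
  obtains K where "0 < K"
    "\<And>l \<Gamma> d. s \<le> l \<Longrightarrow> 0 < l \<Longrightarrow> (\<And>\<nu>. \<nu> \<in> \<Gamma> \<Longrightarrow> stationary (Suc s) \<nu> \<Longrightarrow> d \<le> cond_entropy s \<nu> \<kappa>) \<Longrightarrow>
      (\<Sum>x | x \<in> tuples l \<and> empirical s x \<in> \<Gamma>. path_weight s \<kappa> x)
        \<le> K * (real l + 1) ^ card (tuples (Suc s) :: 'a list set) * exp (- real l * d)"
proof -
  obtain c where c: "0 < c" and W: "\<And>x. s \<le> length x \<Longrightarrow> x \<noteq> [] \<Longrightarrow>
      path_weight s \<kappa> x \<le> exp (real (length x) * (\<Sum>i\<in>tuples (Suc s). empirical s x i * ln (transition \<kappa> i))) / c"
    using path_weight_bounds[OF assms] by metis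
  have ne: "tuples s \<noteq> ({} :: 'a list set)"
    using Ex_list_of_length[of s] by (auto simp: tuples_def)
  define N where "N = real (card (tuples s :: 'a list set))"
  have N: "0 < N" using ne by (simp add: N_def card_gt_0_iff)
  show ?thesis
  proof (rule that[of "N / c"])
    show "0 < N / c" using N c by simp
    fix l \<Gamma> d
    assume l: "s \<le> l" "0 < l" and d: "\<And>\<nu>. \<nu> \<in> \<Gamma> \<Longrightarrow> stationary (Suc s) \<nu> \<Longrightarrow> d \<le> cond_entropy s \<nu> \<kappa>"
    let ?A = "{x. x \<in> tuples l \<and> empirical s x \<in> \<Gamma>}"
    let ?T = "empirical s ` ?A"
    let ?m = "card (tuples (Suc s) :: 'a list set)"
    have fin: "finite ?A" by (rule finite_subset[of _ "tuples l"]) auto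
    have "(\<Sum>x\<in>?A. path_weight s \<kappa> x) = (\<Sum>\<nu>\<in>?T. \<Sum>x | x \<in> ?A \<and> empirical s x = \<nu>. path_weight s \<kappa> x)"
      by (rule sum.image_gen[OF fin])
    also have "\<dots> \<le> (\<Sum>\<nu>\<in>?T. N / c * exp (- real l * d))"
    proof (rule sum_mono)
      fix \<nu> assume "\<nu> \<in> ?T"
      then obtain x0 where x0: "x0 \<in> tuples l" "\<nu> = empirical s x0" "\<nu> \<in> \<Gamma>" by auto
      then have "stationary (Suc s) \<nu>"
        using l stationary_empirical[of s x0] by (auto simp: tuples_def)
      then have D: "d \<le> cond_entropy s \<nu> \<kappa>" using d x0 by blast
      have "{x. x \<in> ?A \<and> empirical s x = \<nu>} = {x. x \<in> tuples l \<and> empirical s x = \<nu>}"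
        using x0 by auto
      then have "(\<Sum>x | x \<in> ?A \<and> empirical s x = \<nu>. path_weight s \<kappa> x)
          \<le> (\<Sum>x | x \<in> tuples l \<and> empirical s x = \<nu>.
              exp (real l * (\<Sum>i\<in>tuples (Suc s). \<nu> i * ln (transition \<kappa> i))) / c)"
        using W l by (simp only:) (rule sum_mono, force simp: tuples_def)
      also have "\<dots> \<le> N * exp (- real l * cond_entropy s \<nu> \<kappa>) / c"
        unfolding sum_divide_distrib[symmetric] N_def
        using c by (intro divide_right_mono sum_type_class l) auto
      also have "\<dots> \<le> N * exp (- real l * d) / c"
        using c N D l by (intro divide_right_mono mult_left_mono) auto
      finally show "(\<Sum>x | x \<in> ?A \<and> empirical s x = \<nu>. path_weight s \<kappa> x) \<le> N / c * exp (- real l * d)"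
        by simp
    qed
    also have "\<dots> = real (card ?T) * (N / c * exp (- real l * d))" by simp
    also have "\<dots> \<le> (real l + 1) ^ ?m * (N / c * exp (- real l * d))"
    proof (rule mult_right_mono)
      have "card ?T \<le> card (empirical s ` (tuples l :: 'a list set))"
        by (intro card_mono) auto
      also have "\<dots> \<le> (l + 1) ^ ?m" by (rule card_types[OF l])
      finally have "real (card ?T) \<le> real ((l + 1) ^ ?m)" by (rule of_nat_mono)
      then show "real (card ?T) \<le> (real l + 1) ^ ?m" by (simp add: add.commute)
    qed (use N c in auto)
    finally show "(\<Sum>x\<in>?A. path_weight s \<kappa> x) \<le> N / c * (real l + 1) ^ ?m * exp (- real l * d)"
      by (simp add: mult_ac)
  qed
qed

subsection \<open>Compactness and change of measure\<close>

text \<open>At 0 the function takes the value 0, which is its right limit there. This carries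
  continuity of the entropy to distributions with zero entries.\<close>

lemma continuous_on_mult_ln: "continuous_on {0..} (\<lambda>x::real. x * ln x)"
  unfolding continuous_on_eq_continuous_within
proof
  fix x :: real assume "x \<in> {0..}"
  show "continuous (at x within {0..}) (\<lambda>x. x * ln x)"
  proof (cases "x = 0")
    case True
    have "((\<lambda>x::real. x * ln x) \<longlongrightarrow> 0) (at_right 0)" by real_asymp
    then show ?thesis using True by (simp add: continuous_within at_within_Ici_at_right)
  next
    case False
    then show ?thesis by (intro continuous_intros) auto
  qed
qed

lemma continuous_on_coordinate: "continuous_on S (\<lambda>\<nu>. \<nu> i)"
  by (rule continuous_on_subset[OF continuous_on_product_coordinates]) simp

text \<open>Finitely many terms \<open>x * ln x\<close> in coordinates and marginals, minus a part
  linear in \<open>\<nu>\<close>. The topology here is that of pointwise convergence of functions on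
  lists.\<close>

lemma continuous_on_cond_entropy:
  fixes S :: "('a::finite list \<Rightarrow> real) set"
  assumes "\<And>\<nu>. \<nu> \<in> S \<Longrightarrow> prob_dist (Suc s) \<nu>"
  shows "continuous_on S (\<lambda>\<nu>. cond_entropy s \<nu> \<kappa>)"
proof -
  have red: "continuous_on S (\<lambda>\<nu>. reduced_dist \<nu> u)" for u
    unfolding reduced_dist_def by (intro continuous_intros continuous_on_coordinate)
  have "continuous_on S (\<lambda>\<nu>. \<nu> i * ln (\<nu> i))" for i
    by (rule continuous_on_compose2[OF continuous_on_mult_ln continuous_on_coordinate])
       (use prob_dist_nonneg[OF assms] in auto)
  moreover have "continuous_on S (\<lambda>\<nu>. reduced_dist \<nu> u * ln (reduced_dist \<nu> u))" for u
    by (rule continuous_on_compose2[OF continuous_on_mult_ln red])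
       (use prob_dist_nonneg[OF prob_dist_reduced[OF assms]] in auto)
  ultimately show ?thesis
    unfolding cond_entropy_def
    by (intro continuous_on_diff continuous_on_sum continuous_on_mult_right continuous_on_coordinate)
qed

lemma closed_prob_dist: "closed {\<nu> :: 'a::finite list \<Rightarrow> real. prob_dist k \<nu>}"
  unfolding prob_dist_def Ball_def
  by (intro closed_Collect_conj closed_Collect_all closed_Collect_imp open_Collect_const
      closed_Collect_le closed_Collect_eq continuous_intros continuous_on_coordinate)

lemma closed_stationary_dists: "closed (stationary_dists k :: ('a::finite list \<Rightarrow> real) set)"
  unfolding stationary_dists_def
proof (induction k)
  case 0
  show ?case by (simp add: closed_prob_dist)
next
  case (Suc k)
  have "continuous_on UNIV (\<lambda>\<nu> :: 'a list \<Rightarrow> real. reduced_dist \<nu>)"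
    unfolding reduced_dist_def
    by (intro continuous_on_coordinatewise_then_product continuous_intros continuous_on_coordinate)
  then have "closed {\<nu> :: 'a list \<Rightarrow> real. stationary k (reduced_dist \<nu>)}"
    using closed_vimage[OF Suc] by (simp add: vimage_def)
  then show ?case
    unfolding stationary.simps Ball_def
    by (intro closed_Collect_conj closed_Collect_all closed_Collect_imp open_Collect_const
      closed_prob_dist closed_Collect_eq continuous_intros continuous_on_coordinate)
qed

text \<open>A closed subset of a product of unit intervals. The product runs over all lists, so its
  compactness is Tychonoff's theorem.\<close>

lemma compact_stationary_dists: "compact (stationary_dists k :: ('a::finite list \<Rightarrow> real) set)"
proof -
  have "compact (PiE UNIV (\<lambda>_. {0..1}) :: ('a list \<Rightarrow> real) set)"
    using compactin_PiE[of "\<lambda>_::'a list. euclidean :: real topology" UNIV "\<lambda>_. {0..1}"]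
    by (simp add: euclidean_product_topology)
  moreover have "(stationary_dists k :: ('a list \<Rightarrow> real) set) \<subseteq> PiE UNIV (\<lambda>_. {0..1})"
  proof
    fix \<nu> :: "'a list \<Rightarrow> real" assume "\<nu> \<in> stationary_dists k"
    then have pd: "prob_dist k \<nu>"
      by (auto simp: stationary_dists_def dest: stationary_imp_prob_dist)
    have "\<nu> i \<le> 1" for i
    proof (cases "i \<in> tuples k")
      case True
      then have "\<nu> i \<le> (\<Sum>i\<in>tuples k. \<nu> i)"
        using prob_dist_nonneg[OF pd] by (intro member_le_sum) auto
      then show ?thesis using pd by (simp add: prob_dist_def)
    next
      case False
      then show ?thesis using pd by (simp add: prob_dist_def)
    qed
    then show "\<nu> \<in> PiE UNIV (\<lambda>_. {0..1})"
      using prob_dist_nonneg[OF pd] by auto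
  qed
  ultimately show ?thesis
    using closed_stationary_dists compact_Int_closed by (metis inf.absorb_iff2)
qed

text \<open>The continuous entropy attains its minimum on the compact set of stationary
  distributions at distance at least \<open>\<epsilon>\<close>. A minimum of 0 would force the
  minimizer to be \<open>\<kappa>\<close>, by the equality case and uniqueness.\<close>

lemma cond_entropy_gap:
  fixes \<kappa> :: "'a::finite list \<Rightarrow> real"
  assumes ka: "stationary (Suc s) \<kappa>" and pos: "\<And>i. i \<in> tuples (Suc s) \<Longrightarrow> 0 < \<kappa> i" and "0 < \<epsilon>"
  obtains \<delta> where "0 < \<delta>"
    "\<And>\<nu>. stationary (Suc s) \<nu> \<Longrightarrow> \<epsilon> \<le> l1_dist (Suc s) \<nu> \<kappa> \<Longrightarrow> \<delta> \<le> cond_entropy s \<nu> \<kappa>"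
proof -
  let ?B = "stationary_dists (Suc s) \<inter> {\<nu>. \<epsilon> \<le> l1_dist (Suc s) \<nu> \<kappa>}"
  have "closed {\<nu> :: 'a list \<Rightarrow> real. \<epsilon> \<le> l1_dist (Suc s) \<nu> \<kappa>}"
    unfolding l1_dist_def by (intro closed_Collect_le continuous_intros continuous_on_coordinate)
  then have comp: "compact ?B" by (rule compact_Int_closed[OF compact_stationary_dists])
  show ?thesis
  proof (cases "?B = {}")
    case True
    then show ?thesis by (intro that[of 1]) (auto simp: stationary_dists_def)
  next
    case False
    have pd: "prob_dist (Suc s) \<nu>" if "\<nu> \<in> ?B" for \<nu>
      using that by (auto simp: stationary_dists_def dest: stationary_imp_prob_dist simp del: stationary.simps)
    obtain \<nu>0 where \<nu>0: "\<nu>0 \<in> ?B" and min: "\<And>\<nu>. \<nu> \<in> ?B \<Longrightarrow> cond_entropy s \<nu>0 \<kappa> \<le> cond_entropy s \<nu> \<kappa>"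
      using continuous_attains_inf[OF comp False continuous_on_cond_entropy[OF pd]] by blast
    have "0 \<le> cond_entropy s \<nu>0 \<kappa>"
      using cond_entropy_nonneg pd[OF \<nu>0] ka[THEN stationary_imp_prob_dist] pos by blast
    moreover have "cond_entropy s \<nu>0 \<kappa> \<noteq> 0"
    proof
      assume "cond_entropy s \<nu>0 \<kappa> = 0"
      then have "\<nu>0 = \<kappa>"
        using \<nu>0 cond_entropy_eq_0D[OF pd[OF \<nu>0] ka[THEN stationary_imp_prob_dist] pos]
        by (intro stationary_unique[OF _ ka pos]) (auto simp: stationary_dists_def simp del: stationary.simps)
      then show False using \<nu>0 \<open>0 < \<epsilon>\<close> by (simp add: l1_dist_def)
    qed
    ultimately show ?thesis
      using min by (intro that[of "cond_entropy s \<nu>0 \<kappa>"]) (auto simp: stationary_dists_def simp del: stationary.simps)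
  qed
qed

text \<open>The law of large numbers for the chain of \<open>\<kappa>\<close>: types far from
  \<open>\<kappa>\<close> have total weight at most polynomial times
  \<open>exp (- real l * \<delta>)\<close>, which tends to 0, and the total mass is 1.\<close>

lemma path_weight_concentrates:
  fixes \<kappa> :: "'a::finite list \<Rightarrow> real"
  assumes ka: "stationary (Suc s) \<kappa>" and pos: "\<And>i. i \<in> tuples (Suc s) \<Longrightarrow> 0 < \<kappa> i" and "0 < \<epsilon>"
  shows "\<forall>\<^sub>F l in sequentially.
    1/2 \<le> (\<Sum>x | x \<in> tuples l \<and> empirical s x \<in> {\<nu>. l1_dist (Suc s) \<nu> \<kappa> < \<epsilon>}. path_weight s \<kappa> x)"
proof -
  note pd = ka[THEN stationary_imp_prob_dist]
  obtain \<delta> where \<delta>: "0 < \<delta>"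
    "\<And>\<nu>. stationary (Suc s) \<nu> \<Longrightarrow> \<epsilon> \<le> l1_dist (Suc s) \<nu> \<kappa> \<Longrightarrow> \<delta> \<le> cond_entropy s \<nu> \<kappa>"
    using cond_entropy_gap[OF assms] by blast
  define m where "m = card (tuples (Suc s) :: 'a list set)"
  obtain K where K: "0 < K" "\<And>l \<Gamma> d. s \<le> l \<Longrightarrow> 0 < l \<Longrightarrow>
      (\<And>\<nu>. \<nu> \<in> \<Gamma> \<Longrightarrow> stationary (Suc s) \<nu> \<Longrightarrow> d \<le> cond_entropy s \<nu> \<kappa>) \<Longrightarrow>
      (\<Sum>x | x \<in> tuples l \<and> empirical s x \<in> \<Gamma>. path_weight s \<kappa> x) \<le> K * (real l + 1) ^ m * exp (- real l * d)"
    using path_weight_upper[OF pd pos] unfolding m_def by blast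
  have "((\<lambda>l. K * (real l + 1) ^ m * exp (- real l * \<delta>)) \<longlongrightarrow> 0) sequentially"
    using K(1) \<delta>(1) by real_asymp
  then have "\<forall>\<^sub>F l in sequentially. K * (real l + 1) ^ m * exp (- real l * \<delta>) < 1/2"
    by (rule order_tendstoD) simp
  \<comment> \<open>The bound \<open>Suc s\<close> secures both \<open>s \<le> l\<close> and
    \<open>0 < l\<close>.\<close>
  with eventually_ge_at_top[of "Suc s"] show ?thesis
  proof eventually_elim
    case (elim l)
    let ?far = "{x. x \<in> tuples l \<and> empirical s x \<in> {\<nu>. \<epsilon> \<le> l1_dist (Suc s) \<nu> \<kappa>}}"
    let ?near = "{x. x \<in> tuples l \<and> empirical s x \<in> {\<nu>. l1_dist (Suc s) \<nu> \<kappa> < \<epsilon>}}"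
    have "(\<Sum>x\<in>?far. path_weight s \<kappa> x) \<le> K * (real l + 1) ^ m * exp (- real l * \<delta>)"
      using \<delta>(2) elim by (intro K(2)) (auto simp del: stationary.simps)
    moreover have "?far \<union> ?near = tuples l" by auto
    then have "(\<Sum>x\<in>?far. path_weight s \<kappa> x) + (\<Sum>x\<in>?near. path_weight s \<kappa> x)
        = (\<Sum>x\<in>tuples l. path_weight s \<kappa> x)"
      by (subst sum.union_disjoint[symmetric]) (auto intro: finite_subset[of _ "tuples l"])
    moreover have "(\<Sum>x\<in>tuples l. path_weight s \<kappa> x) = 1"
      using elim by (intro sum_path_weight pd pos) auto
    ultimately show ?case using elim by linarith
  qed
qed

text \<open>The logarithm of the ratio of \<open>\<mu>\<close>-weight to
  \<open>\<kappa>\<close>-weight is, up to a constant, \<open>l\<close> times a linear function of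
  the type, whose value at \<open>\<kappa>\<close> is
  \<open>- cond_entropy s \<kappa> \<mu>\<close>. Near \<open>\<kappa>\<close> it changes by at most
  \<open>\<eta>\<close>, and the paths with such types have \<open>\<kappa>\<close>-weight at least
  1/2.\<close>

lemma path_weight_lower_positive:
  fixes \<kappa> \<mu> :: "'a::finite list \<Rightarrow> real"
  assumes ka: "stationary (Suc s) \<kappa>" and ka_pos: "\<And>i. i \<in> tuples (Suc s) \<Longrightarrow> 0 < \<kappa> i"
    and mu: "prob_dist (Suc s) \<mu>" and mu_pos: "\<And>i. i \<in> tuples (Suc s) \<Longrightarrow> 0 < \<mu> i"
    and "0 < \<epsilon>" "0 < \<eta>"
    and near: "\<And>\<nu>. stationary (Suc s) \<nu> \<Longrightarrow> l1_dist (Suc s) \<nu> \<kappa> < \<epsilon> \<Longrightarrow> \<nu> \<in> \<Gamma>"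
  obtains C where "0 < C"
    "\<forall>\<^sub>F l in sequentially. C * exp (- real l * (cond_entropy s \<kappa> \<mu> + \<eta>))
      \<le> (\<Sum>x | x \<in> tuples l \<and> empirical s x \<in> \<Gamma>. path_weight s \<mu> x)"
proof -
  note pd = ka[THEN stationary_imp_prob_dist]
  define h where "h i = ln (transition \<mu> i) - ln (transition \<kappa> i)" for i
  \<comment> \<open>\<open>B\<close> bounds every \<open>\<bar>h i\<bar>\<close>; the added 1 makes
    it a positive divisor.\<close>
  define B where "B = 1 + (\<Sum>i\<in>tuples (Suc s). \<bar>h i\<bar>)"
  have B: "0 < B" unfolding B_def by (intro add_pos_nonneg sum_nonneg) auto
  have hB: "\<bar>h i\<bar> \<le> B" if "i \<in> tuples (Suc s)" for i
    using member_le_sum[OF that, of "\<lambda>i. \<bar>h i\<bar>"] by (simp add: B_def)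
  \<comment> \<open>Within this distance of \<open>\<kappa>\<close> the average of \<open>h\<close>
    moves by at most \<open>\<eta>\<close>.\<close>
  define \<epsilon>' where "\<epsilon>' = min \<epsilon> (\<eta> / B)"
  have \<epsilon>': "0 < \<epsilon>'" "\<epsilon>' \<le> \<epsilon>" "\<epsilon>' * B \<le> \<eta>"
    using assms B by (auto simp: \<epsilon>'_def field_simps min_def)
  have shift: "- cond_entropy s \<kappa> \<mu> - \<eta> \<le> (\<Sum>i\<in>tuples (Suc s). \<nu> i * h i)"
    if "l1_dist (Suc s) \<nu> \<kappa> < \<epsilon>'" for \<nu>
  proof -
    have "(\<Sum>i\<in>tuples (Suc s). \<kappa> i * h i) = - cond_entropy s \<kappa> \<mu>"
      by (simp add: cond_entropy_eq[OF pd] h_def sum_negf[symmetric] algebra_simps)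
    moreover have "\<bar>\<Sum>i\<in>tuples (Suc s). (\<nu> i - \<kappa> i) * h i\<bar> \<le> (\<Sum>i\<in>tuples (Suc s). \<bar>\<nu> i - \<kappa> i\<bar> * B)"
      using hB by (intro order_trans[OF sum_abs] sum_mono) (auto simp: abs_mult intro: mult_left_mono)
    moreover have "(\<Sum>i\<in>tuples (Suc s). \<bar>\<nu> i - \<kappa> i\<bar> * B) \<le> \<epsilon>' * B"
      using that B by (simp add: l1_dist_def flip: sum_distrib_right)
    ultimately show ?thesis using \<epsilon>'(3)
      by (simp add: left_diff_distrib sum_subtractf)
  qed
  obtain c where c: "0 < c" "\<And>x. s \<le> length x \<Longrightarrow> x \<noteq> [] \<Longrightarrow>
      c * exp (real (length x) * (\<Sum>i\<in>tuples (Suc s). empirical s x i * ln (transition \<mu> i))) \<le> path_weight s \<mu> x"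
    using path_weight_bounds[OF mu mu_pos] by metis
  obtain c' where c': "0 < c'" "\<And>x. s \<le> length x \<Longrightarrow> x \<noteq> [] \<Longrightarrow>
      path_weight s \<kappa> x \<le> exp (real (length x) * (\<Sum>i\<in>tuples (Suc s). empirical s x i * ln (transition \<kappa> i))) / c'"
    using path_weight_bounds[OF pd ka_pos] by metis
  have reweight: "c * c' * exp (- real l * (cond_entropy s \<kappa> \<mu> + \<eta>)) * path_weight s \<kappa> x \<le> path_weight s \<mu> x"
    if l: "s \<le> l" "0 < l" and x: "x \<in> tuples l" "l1_dist (Suc s) (empirical s x) \<kappa> < \<epsilon>'" for l x
  proof -
    have len: "length x = l" "x \<noteq> []" using x l by (auto simp: tuples_def)
    define E where "E \<rho> = (\<Sum>i\<in>tuples (Suc s). empirical s x i * ln (transition \<rho> i))" for \<rho>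
    have "E \<mu> - E \<kappa> = (\<Sum>i\<in>tuples (Suc s). empirical s x i * h i)"
      by (simp add: E_def h_def sum_subtractf right_diff_distrib)
    then have "E \<kappa> - (cond_entropy s \<kappa> \<mu> + \<eta>) \<le> E \<mu>"
      using shift[OF x(2)] by simp
    then have "real l * (E \<kappa> - (cond_entropy s \<kappa> \<mu> + \<eta>)) \<le> real l * E \<mu>"
      by (intro mult_left_mono) auto
    then have exps: "exp (- real l * (cond_entropy s \<kappa> \<mu> + \<eta>)) * exp (real l * E \<kappa>) \<le> exp (real l * E \<mu>)"
      by (simp add: algebra_simps flip: exp_add)
    have "c' * path_weight s \<kappa> x \<le> exp (real l * E \<kappa>)"
      using c'(2)[of x] c'(1) len l by (simp add: E_def le_divide_eq mult.commute)
    then have "exp (- real l * (cond_entropy s \<kappa> \<mu> + \<eta>)) * (c' * path_weight s \<kappa> x) \<le> exp (real l * E \<mu>)"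
      using exps by (meson exp_ge_zero mult_left_mono order_trans)
    then have "c * (exp (- real l * (cond_entropy s \<kappa> \<mu> + \<eta>)) * (c' * path_weight s \<kappa> x)) \<le> c * exp (real l * E \<mu>)"
      using c(1) by simp
    also have "\<dots> \<le> path_weight s \<mu> x"
      using c(2)[of x] len l by (simp add: E_def)
    finally show ?thesis by (simp add: mult_ac)
  qed
  have concentrates: "\<forall>\<^sub>F l in sequentially.
      1/2 \<le> (\<Sum>x | x \<in> tuples l \<and> empirical s x \<in> {\<nu>. l1_dist (Suc s) \<nu> \<kappa> < \<epsilon>'}. path_weight s \<kappa> x)"
    by (intro path_weight_concentrates ka ka_pos \<epsilon>'(1))
  show ?thesis
  proof (rule that[of "c * c' / 2"])
    show "0 < c * c' / 2" using c(1) c'(1) by simp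
    show "\<forall>\<^sub>F l in sequentially. c * c' / 2 * exp (- real l * (cond_entropy s \<kappa> \<mu> + \<eta>))
      \<le> (\<Sum>x | x \<in> tuples l \<and> empirical s x \<in> \<Gamma>. path_weight s \<mu> x)"
      using concentrates eventually_ge_at_top[of "Suc s"]
    proof eventually_elim
      case (elim l)
      let ?near = "{x. x \<in> tuples l \<and> empirical s x \<in> {\<nu>. l1_dist (Suc s) \<nu> \<kappa> < \<epsilon>'}}"
      define e where "e = c * c' * exp (- real l * (cond_entropy s \<kappa> \<mu> + \<eta>))"
      have "0 \<le> e" using c(1) c'(1) by (simp add: e_def)
      then have "e * (1/2) \<le> e * (\<Sum>x\<in>?near. path_weight s \<kappa> x)"
        using elim by (intro mult_left_mono) auto
      also have "\<dots> \<le> (\<Sum>x\<in>?near. path_weight s \<mu> x)"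
        unfolding sum_distrib_left e_def using elim by (intro sum_mono reweight[of l]) auto
      also have "\<dots> \<le> (\<Sum>x | x \<in> tuples l \<and> empirical s x \<in> \<Gamma>. path_weight s \<mu> x)"
      proof (rule sum_mono2)
        show "?near \<subseteq> {x. x \<in> tuples l \<and> empirical s x \<in> \<Gamma>}"
        proof safe
          fix x :: "'a list" assume x: "x \<in> tuples l" "l1_dist (Suc s) (empirical s x) \<kappa> < \<epsilon>'"
          then have "stationary (Suc s) (empirical s x)"
            using elim by (intro stationary_empirical) (auto simp: tuples_def)
          then show "empirical s x \<in> \<Gamma>" using near x(2) \<epsilon>'(2) by (meson less_le_trans)
        qed
      qed (auto intro: finite_subset[of _ "tuples l"] path_weight_nonneg[OF mu])
      finally show ?case by (simp add: e_def mult_ac)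
    qed
  qed
qed

section \<open>Approximation by positive stationary distributions\<close>

lemma reduced_dist_convex:
  "reduced_dist (\<lambda>i. a * \<nu> i + b * \<mu> i) = (\<lambda>i. a * reduced_dist \<nu> i + b * reduced_dist \<mu> i)"
  by (rule ext) (simp add: reduced_dist_def sum.distrib sum_distrib_left)

lemma prob_dist_convex:
  assumes "prob_dist k \<nu>" "prob_dist k \<mu>" "0 \<le> a" "0 \<le> b" "a + b = 1"
  shows "prob_dist k (\<lambda>i. a * \<nu> i + b * \<mu> i)"
  using assms by (simp add: prob_dist_def sum.distrib flip: sum_distrib_left)

lemma stationary_convex:
  assumes "stationary k \<nu>" "stationary k \<mu>" "0 \<le> a" "0 \<le> b" "a + b = 1"
  shows "stationary k (\<lambda>i. a * \<nu> i + b * \<mu> i)"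
  using assms(1,2)
proof (induction k arbitrary: \<nu> \<mu>)
  case 0
  then show ?case using prob_dist_convex assms by simp
next
  case (Suc k)
  then show ?case
    using prob_dist_convex[of "Suc k" \<nu> \<mu> a b] assms(3-5)
    by (simp add: reduced_dist_convex sum.distrib flip: sum_distrib_left)
qed

text \<open>Mixing in a small portion \<open>\<theta>\<close> of the positive \<open>\<mu>\<close>
  makes every entry positive and keeps stationarity. Distance and entropy are continuous in
  \<open>\<theta>\<close>, hence close to their values at 0.\<close>

lemma positive_approximation:
  fixes \<nu> \<mu> :: "'a::finite list \<Rightarrow> real"
  assumes nu: "stationary (Suc s) \<nu>" and mu: "stationary (Suc s) \<mu>"
    and pos: "\<And>i. i \<in> tuples (Suc s) \<Longrightarrow> 0 < \<mu> i" and "0 < \<epsilon>" "0 < \<eta>"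
  obtains \<kappa> where "stationary (Suc s) \<kappa>" "\<And>i. i \<in> tuples (Suc s) \<Longrightarrow> 0 < \<kappa> i"
    "l1_dist (Suc s) \<kappa> \<nu> < \<epsilon>" "cond_entropy s \<kappa> \<mu> < cond_entropy s \<nu> \<mu> + \<eta>"
proof -
  define \<kappa> where "\<kappa> \<theta> = (\<lambda>i. (1 - \<theta>) * \<nu> i + \<theta> * \<mu> i)" for \<theta> :: real
  have stat: "stationary (Suc s) (\<kappa> \<theta>)" if "\<theta> \<in> {0..1}" for \<theta>
    unfolding \<kappa>_def using that by (intro stationary_convex nu mu) auto
  have cont: "continuous_on {0..1} \<kappa>"
    unfolding \<kappa>_def by (intro continuous_on_coordinatewise_then_product continuous_intros)
  have "continuous_on {0..1} (\<lambda>\<theta>. cond_entropy s (\<kappa> \<theta>) \<mu>)"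
    \<comment> \<open>Continuity of the entropy is available on sets of distributions, hence the
      image of the unit interval as domain.\<close>
    by (rule continuous_on_compose2[OF continuous_on_cond_entropy[of "\<kappa> ` {0..1}"] cont])
       (auto dest!: stat[THEN stationary_imp_prob_dist])
  moreover have "continuous_on {0..1} (\<lambda>\<theta>. l1_dist (Suc s) (\<kappa> \<theta>) \<nu>)"
    unfolding l1_dist_def \<kappa>_def by (intro continuous_intros)
  moreover have "\<kappa> 0 = \<nu>" by (simp add: \<kappa>_def)
  ultimately have "((\<lambda>\<theta>. cond_entropy s (\<kappa> \<theta>) \<mu>) \<longlongrightarrow> cond_entropy s \<nu> \<mu>) (at_right 0)"
    "((\<lambda>\<theta>. l1_dist (Suc s) (\<kappa> \<theta>) \<nu>) \<longlongrightarrow> l1_dist (Suc s) \<nu> \<nu>) (at_right 0)"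
    by (auto simp: continuous_on_def at_within_Icc_at_right dest: bspec[of _ _ 0])
  then have "\<forall>\<^sub>F \<theta> in at_right 0. cond_entropy s (\<kappa> \<theta>) \<mu> < cond_entropy s \<nu> \<mu> + \<eta>"
    "\<forall>\<^sub>F \<theta> in at_right 0. l1_dist (Suc s) (\<kappa> \<theta>) \<nu> < \<epsilon>"
    using assms(4,5) by (auto elim!: order_tendstoD(2) simp: l1_dist_def)
  moreover have "\<forall>\<^sub>F \<theta> in at_right 0. \<theta> \<in> {0<..<1::real}"
    by (rule eventually_at_right_real) simp
  ultimately have "\<forall>\<^sub>F \<theta> in at_right 0. cond_entropy s (\<kappa> \<theta>) \<mu> < cond_entropy s \<nu> \<mu> + \<eta>
      \<and> l1_dist (Suc s) (\<kappa> \<theta>) \<nu> < \<epsilon> \<and> \<theta> \<in> {0<..<1::real}"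
    by eventually_elim simp
  then obtain \<theta> where \<theta>: "cond_entropy s (\<kappa> \<theta>) \<mu> < cond_entropy s \<nu> \<mu> + \<eta>"
      "l1_dist (Suc s) (\<kappa> \<theta>) \<nu> < \<epsilon>" "\<theta> \<in> {0<..<1::real}"
    using eventually_happens'[OF trivial_limit_at_right_real] by blast
  show ?thesis
  proof (rule that[of "\<kappa> \<theta>"])
    show "stationary (Suc s) (\<kappa> \<theta>)" using stat \<theta>(3) by auto
    show "0 < \<kappa> \<theta> i" if "i \<in> tuples (Suc s)" for i
      using \<theta>(3) pos[OF that] prob_dist_nonneg[OF nu[THEN stationary_imp_prob_dist], of i]
      by (auto simp: \<kappa>_def intro!: add_nonneg_pos)
  qed (use \<theta> in auto)
qed

text \<open>Extends the lower bound to targets with zero entries: half of \<open>\<epsilon>\<close>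
  and \<open>\<eta>\<close> is spent on a positive approximation \<open>\<kappa>\<close>, the other
  half on the change of measure to \<open>\<kappa>\<close>.\<close>

lemma path_weight_lower:
  fixes \<nu> \<mu> :: "'a::finite list \<Rightarrow> real"
  assumes nu: "stationary (Suc s) \<nu>" and mu: "stationary (Suc s) \<mu>"
    and pos: "\<And>i. i \<in> tuples (Suc s) \<Longrightarrow> 0 < \<mu> i" and "0 < \<epsilon>" "0 < \<eta>"
    and near: "\<And>\<rho>. stationary (Suc s) \<rho> \<Longrightarrow> l1_dist (Suc s) \<rho> \<nu> < \<epsilon> \<Longrightarrow> \<rho> \<in> \<Gamma>"
  obtains C where "0 < C"
    "\<forall>\<^sub>F l in sequentially. C * exp (- real l * (cond_entropy s \<nu> \<mu> + \<eta>))
      \<le> (\<Sum>x | x \<in> tuples l \<and> empirical s x \<in> \<Gamma>. path_weight s \<mu> x)"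
proof -
  note pd = mu[THEN stationary_imp_prob_dist]
  have half: "0 < \<epsilon> / 2" "0 < \<eta> / 2" using assms(4,5) by auto
  obtain \<kappa> where ka: "stationary (Suc s) \<kappa>" "\<And>i. i \<in> tuples (Suc s) \<Longrightarrow> 0 < \<kappa> i"
    "l1_dist (Suc s) \<kappa> \<nu> < \<epsilon> / 2" "cond_entropy s \<kappa> \<mu> < cond_entropy s \<nu> \<mu> + \<eta> / 2"
    using positive_approximation[OF nu mu pos half] by metis
  have near': "\<rho> \<in> \<Gamma>" if "stationary (Suc s) \<rho>" "l1_dist (Suc s) \<rho> \<kappa> < \<epsilon> / 2" for \<rho>
  proof (rule near[OF that(1)])
    have "l1_dist (Suc s) \<rho> \<nu> \<le> l1_dist (Suc s) \<rho> \<kappa> + l1_dist (Suc s) \<kappa> \<nu>"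
      unfolding l1_dist_def sum.distrib[symmetric] by (rule sum_mono) linarith
    then show "l1_dist (Suc s) \<rho> \<nu> < \<epsilon>" using that(2) ka(3) by simp
  qed
  obtain C where C: "0 < C" "\<forall>\<^sub>F l in sequentially. C * exp (- real l * (cond_entropy s \<kappa> \<mu> + \<eta> / 2))
      \<le> (\<Sum>x | x \<in> tuples l \<and> empirical s x \<in> \<Gamma>. path_weight s \<mu> x)"
    by (rule path_weight_lower_positive[OF ka(1,2) pd pos half near'])
  have le: "C * exp (- real l * (cond_entropy s \<nu> \<mu> + \<eta>)) \<le> C * exp (- real l * (cond_entropy s \<kappa> \<mu> + \<eta> / 2))" for l
    using C(1) ka(4) by (auto simp: intro!: mult_left_mono)
  show thesis
    by (rule that[OF C(1)]) (rule eventually_mono[OF C(2)], rule order_trans[OF le])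
qed

subsection \<open>Processes\<close>

lemma block_Suc: "block X t (Suc m) \<omega> = block X t m \<omega> @ [X (t + m) \<omega>]"
  by (simp add: block_def)

lemma block_in_tuples [simp]: "block X t m \<omega> \<in> tuples m"
  by (simp add: block_def tuples_def)

lemma block_shift: "map (\<lambda>t. X (t + h) \<omega>) [0..<m] = block X h m \<omega>"
  by (rule nth_equalityI) (simp_all add: block_def add.commute)

lemma block_eq_iff: "block X t m \<omega> = xs \<longleftrightarrow> length xs = m \<and> (\<forall>r<m. X (t + r) \<omega> = xs ! r)"
  by (auto simp: block_def list_eq_iff_nth_eq)

lemma sets_block:
  assumes [measurable]: "\<And>t. X t \<in> M \<rightarrow>\<^sub>M count_space UNIV"
  shows "{\<omega> \<in> space M. block X t m \<omega> = xs} \<in> sets M"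
  unfolding block_eq_iff by measurable

lemma prob_block_in:
  fixes X :: "nat \<Rightarrow> 'w \<Rightarrow> 'a::finite"
  assumes "prob_space M" "\<And>t. X t \<in> M \<rightarrow>\<^sub>M count_space UNIV"
  shows "\<P>(\<omega> in M. P (block X t m \<omega>)) = (\<Sum>x | x \<in> tuples m \<and> P x. \<P>(\<omega> in M. block X t m \<omega> = x))"
proof -
  interpret prob_space M by fact
  have "{\<omega> \<in> space M. P (block X t m \<omega>)} = (\<Union>x\<in>{x \<in> tuples m. P x}. {\<omega> \<in> space M. block X t m \<omega> = x})"
    by auto
  moreover have "measure M \<dots> = (\<Sum>x | x \<in> tuples m \<and> P x. \<P>(\<omega> in M. block X t m \<omega> = x))"
    by (rule finite_measure_finite_Union)
       (use sets_block[OF assms(2)] in \<open>auto simp: disjoint_family_on_def intro: finite_subset[of _ "tuples m"]\<close>)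
  ultimately show ?thesis by simp
qed

lemma prob_block_reduced:
  fixes X :: "nat \<Rightarrow> 'w \<Rightarrow> 'a::finite"
  assumes "prob_space M" "\<And>t. X t \<in> M \<rightarrow>\<^sub>M count_space UNIV"
    and \<mu>: "\<And>i. i \<in> tuples (Suc s) \<Longrightarrow> \<mu> i = \<P>(\<omega> in M. block X t (Suc s) \<omega> = i)"
    and u: "u \<in> tuples s"
  shows "\<P>(\<omega> in M. block X t s \<omega> = u) = reduced_dist \<mu> u"
proof -
  have snoc: "u @ [a] \<in> tuples (Suc s)" for a
    using u by (simp add: tuples_def)
  have split: "butlast i @ [last i] = i" if "i \<in> tuples (Suc s)" for i :: "'a list"
    using that by (intro append_butlast_last_id) (auto simp: tuples_def)
  have "\<P>(\<omega> in M. block X t s \<omega> = u) = \<P>(\<omega> in M. butlast (block X t (Suc s) \<omega>) = u)"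
    by (simp add: block_Suc)
  also have "\<dots> = (\<Sum>i | i \<in> tuples (Suc s) \<and> butlast i = u. \<P>(\<omega> in M. block X t (Suc s) \<omega> = i))"
    by (rule prob_block_in[OF assms(1,2)])
  also have "\<dots> = (\<Sum>i | i \<in> tuples (Suc s) \<and> butlast i = u. \<mu> i)"
    using \<mu> by (intro sum.cong) auto
  also have "\<dots> = (\<Sum>a\<in>UNIV. \<mu> (u @ [a]))"
    by (rule sum.reindex_bij_witness[of _ "\<lambda>a. u @ [a]" last]) (auto simp: snoc split)
  finally show ?thesis by (simp add: reduced_dist_def)
qed

text \<open>By induction on the length: the Markov property replaces the past by its last
  \<open>s\<close> letters, and the conditional law given these is \<open>transition \<mu>\<close>,
  since \<open>\<mu>\<close> is the block distribution at every time.\<close>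

lemma prob_block_eq_path_weight:
  fixes X :: "nat \<Rightarrow> 'w \<Rightarrow> 'a::finite"
  assumes "prob_space M" and meas: "\<And>t. X t \<in> M \<rightarrow>\<^sub>M count_space UNIV"
    and markov: "markov_process M s X"
    and \<mu>: "\<And>t i. i \<in> tuples (Suc s) \<Longrightarrow> \<mu> i = \<P>(\<omega> in M. block X t (Suc s) \<omega> = i)"
    and l: "s \<le> l" and x: "x \<in> tuples l"
  shows "\<P>(\<omega> in M. block X 0 l \<omega> = x) = path_weight s \<mu> x"
  using l x
proof (induction l arbitrary: x rule: dec_induct)
  case base
  then show ?case
    using prob_block_reduced[of M X s \<mu> 0 x] assms(1) meas \<mu>
    by (simp add: path_weight_def path_prod_def tuples_def)
next
  case (step l)
  interpret prob_space M by fact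
  obtain xs a where xs: "x = xs @ [a]" "xs \<in> tuples l"
    using step.prems by (cases x rule: rev_cases) (auto simp: tuples_def)
  define u where "u = drop (l - s) xs"
  have u: "u \<in> tuples s" using xs(2) step(1) by (simp add: u_def tuples_def)
  have "\<P>(\<omega> in M. block X 0 (Suc l) \<omega> = x) = \<P>(\<omega> in M. block X 0 l \<omega> = xs) * transition \<mu> (u @ [a])"
  proof (cases "\<P>(\<omega> in M. block X 0 l \<omega> = xs) = 0")
    \<comment> \<open>The Markov property is silent about pasts of probability 0; there both sides
      are 0.\<close>
    case True
    have "\<P>(\<omega> in M. block X 0 (Suc l) \<omega> = x) \<le> \<P>(\<omega> in M. block X 0 l \<omega> = xs)"
      by (rule finite_measure_mono) (auto simp: block_Suc xs intro!: sets_block meas)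
    then show ?thesis using True by (simp add: measure_le_0_iff)
  next
    case False
    then have pos: "0 < \<P>(\<omega> in M. block X 0 l \<omega> = xs)" by (simp add: zero_less_measure_iff)
    have "\<P>(\<omega> in M. block X 0 (Suc l) \<omega> = x) / \<P>(\<omega> in M. block X 0 l \<omega> = xs)
        = \<P>(\<omega> in M. X l \<omega> = a \<bar> block X 0 l \<omega> = xs)"
      by (simp add: cond_prob_def block_Suc xs conj_commute)
    also have "\<dots> = \<P>(\<omega> in M. X l \<omega> = a \<bar> block X (l - s) s \<omega> = u)"
      using markov step(1) pos by (simp add: markov_process_def u_def)
    also have "\<dots> = \<P>(\<omega> in M. block X (l - s) (Suc s) \<omega> = u @ [a]) / \<P>(\<omega> in M. block X (l - s) s \<omega> = u)"
      using step(1) by (simp add: cond_prob_def block_Suc conj_commute)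
    also have "\<dots> = transition \<mu> (u @ [a])"
      using u prob_block_reduced[of M X s \<mu> "l - s" u] assms(1) meas \<mu> \<mu>[of "u @ [a]" "l - s"]
      by (simp add: transition_def tuples_def)
    finally show ?thesis using pos by (simp add: field_simps)
  qed
  also have "\<dots> = path_weight s \<mu> x"
    using step xs by (simp add: path_weight_def path_prod_snoc u_def tuples_def)
  finally show ?case .
qed

section \<open>From exponential bounds to limits of normalized logarithms\<close>

lemma log_prob_le:
  assumes "0 \<le> p" "p \<le> K * (real l + 1) ^ m * exp (- real l * d)" "0 < K" "0 < l"
  shows "ereal (1 / real l) * log_prob p \<le> ereal (ln K / real l + real m * ln (real l + 1) / real l - d)"
proof (cases "p = 0")
  case True
  then show ?thesis using assms(4) by (simp add: log_prob_def)
next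
  case False
  then have "ln p \<le> ln (K * (real l + 1) ^ m * exp (- real l * d))"
    using assms by (subst ln_le_cancel_iff) auto
  also have "\<dots> = ln K + real m * ln (real l + 1) - real l * d"
    using assms(3) by (simp add: ln_mult ln_realpow)
  finally have "ln p / real l \<le> (ln K + real m * ln (real l + 1) - real l * d) / real l"
    by (rule divide_right_mono) simp
  then show ?thesis using False assms(4) by (simp add: log_prob_def add_divide_distrib diff_divide_distrib)
qed

lemma log_prob_ge:
  assumes "C * exp (- real l * d) \<le> p" "0 < C" "0 < l"
  shows "ereal (ln C / real l - d) \<le> ereal (1 / real l) * log_prob p"
proof -
  have pos: "0 < C * exp (- real l * d)" using assms(2) by simp
  have p: "0 < p" using pos assms(1) by linarith
  have "ln C - real l * d = ln (C * exp (- real l * d))"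
    using assms(2) by (simp add: ln_mult)
  also have "\<dots> \<le> ln p"
    using assms(1) pos by (subst ln_le_cancel_iff) auto
  finally have "(ln C - real l * d) / real l \<le> ln p / real l"
    by (rule divide_right_mono) simp
  then show ?thesis using assms(3) p by (simp add: log_prob_def diff_divide_distrib)
qed

text \<open>After taking logarithms and dividing by \<open>l\<close>, the constant and the
  polynomial factor tend to 0.\<close>

lemma limsup_log_prob_le:
  assumes "0 < K" "\<And>l. 0 \<le> p l" "\<forall>\<^sub>F l in sequentially. p l \<le> K * (real l + 1) ^ m * exp (- real l * d)"
  shows "limsup (\<lambda>l. ereal (1 / real l) * log_prob (p l)) \<le> ereal (- d)"
proof -
  have "\<forall>\<^sub>F l in sequentially. ereal (1 / real l) * log_prob (p l)
      \<le> ereal (ln K / real l + real m * ln (real l + 1) / real l - d)"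
    using assms(3) eventually_gt_at_top[of 0]
    by eventually_elim (intro log_prob_le assms)
  then have "limsup (\<lambda>l. ereal (1 / real l) * log_prob (p l))
      \<le> limsup (\<lambda>l. ereal (ln K / real l + real m * ln (real l + 1) / real l - d))"
    by (rule Limsup_mono)
  also have "(\<lambda>l. ln K / real l + real m * ln (real l + 1) / real l - d) \<longlonglongrightarrow> - d"
    by real_asymp
  then have "limsup (\<lambda>l. ereal (ln K / real l + real m * ln (real l + 1) / real l - d)) = ereal (- d)"
    by (intro lim_imp_Limsup) auto
  finally show ?thesis .
qed

lemma liminf_log_prob_ge:
  assumes "0 < C" "\<forall>\<^sub>F l in sequentially. C * exp (- real l * d) \<le> p l"
  shows "ereal (- d) \<le> liminf (\<lambda>l. ereal (1 / real l) * log_prob (p l))"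
proof -
  have "(\<lambda>l. ln C / real l - d) \<longlonglongrightarrow> - d"
    by real_asymp
  then have "ereal (- d) = liminf (\<lambda>l. ereal (ln C / real l - d))"
    by (intro lim_imp_Liminf[symmetric]) auto
  also have "\<forall>\<^sub>F l in sequentially. ereal (ln C / real l - d) \<le> ereal (1 / real l) * log_prob (p l)"
    using assms(2) eventually_gt_at_top[of 0]
    by eventually_elim (intro log_prob_ge assms)
  then have "liminf (\<lambda>l. ereal (ln C / real l - d)) \<le> liminf (\<lambda>l. ereal (1 / real l) * log_prob (p l))"
    by (rule Liminf_mono)
  finally show ?thesis .
qed

lemma openin_stationary_topologyE:
  assumes "openin (stationary_topology k) \<Gamma>" "\<nu> \<in> \<Gamma>"
  obtains \<epsilon> where "0 < \<epsilon>" "\<And>\<kappa>. stationary k \<kappa> \<Longrightarrow> l1_dist k \<kappa> \<nu> < \<epsilon> \<Longrightarrow> \<kappa> \<in> \<Gamma>"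
proof -
  interpret S: Metric_space "stationary_dists k" "l1_dist k"
    by (rule Metric_space_stationary_dists)
  obtain r where r: "0 < r" "S.mball \<nu> r \<subseteq> \<Gamma>"
    using assms unfolding stationary_topology_def S.openin_mtopology by blast
  have "\<nu> \<in> stationary_dists k"
    using openin_subset[OF assms(1)] assms(2) by auto
  then have "\<kappa> \<in> S.mball \<nu> r" if "stationary k \<kappa>" "l1_dist k \<kappa> \<nu> < r" for \<kappa>
    unfolding S.in_mball S.commute[of \<nu>] using that by (simp add: stationary_dists_def)
  then show thesis using that r by blast
qed

section \<open>The large deviation property of the empirical measures\<close>

theorem theorem8:
  fixes M :: "'w measure"
    and X :: "nat \<Rightarrow> 'w \<Rightarrow> 'a::finite"
    and s :: nat
    and \<mu> :: "'a list \<Rightarrow> real"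
  assumes "prob_space M"
    and "\<And>t. X t \<in> M \<rightarrow>\<^sub>M count_space UNIV"
    and "s \<ge> 1"
    and "stationary_process M X"
    and "markov_process M s X"
    and "\<mu> \<in> stationary_dists (s + 1)"
    and "\<And>t i. i \<in> tuples (s + 1) \<Longrightarrow> \<mu> i = \<P>(\<omega> in M. block X t (s + 1) \<omega> = i)"
    and "\<And>i. i \<in> tuples (s + 1) \<Longrightarrow> \<mu> i > 0"
  shows "(\<forall>l\<ge>s. \<forall>\<omega>\<in>space M. empirical s (block X 1 l \<omega>) \<in> stationary_dists (s + 1)) \<and>
    satisfies_LDP M (stationary_topology (s + 1))
      (\<lambda>\<nu>. cond_rel_entropy s \<nu> \<mu>) (\<lambda>l \<omega>. empirical s (block X 1 l \<omega>))"
proof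
  have stat: "stationary (Suc s) \<mu>"
    using assms(6) by (simp add: stationary_dists_def del: stationary.simps)
  note pd = stat[THEN stationary_imp_prob_dist]
  have pos: "0 < \<mu> i" if "i \<in> tuples (Suc s)" for i
    using assms(8) that by simp
  have \<mu>: "\<mu> i = \<P>(\<omega> in M. block X t (Suc s) \<omega> = i)" if "i \<in> tuples (Suc s)" for t i
    using assms(7) that by simp
  define p where "p \<Gamma> l = \<P>(\<omega> in M. empirical s (block X 1 l \<omega>) \<in> \<Gamma>)" for \<Gamma> l
  have p: "p \<Gamma> l = (\<Sum>x | x \<in> tuples l \<and> empirical s x \<in> \<Gamma>. path_weight s \<mu> x)" if "s \<le> l" for \<Gamma> l
  proof -
    have "\<P>(\<omega> in M. block X 1 l \<omega> = x) = path_weight s \<mu> x" if "x \<in> tuples l" for x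
    proof -
      \<comment> \<open>The sample path starts at time 1 and the Markov property conditions on pasts
        from time 0; stationarity of the process bridges the shift.\<close>
      have "\<P>(\<omega> in M. block X 1 l \<omega> = x) = \<P>(\<omega> in M. block X 0 l \<omega> = x)"
        using assms(4)[unfolded stationary_process_def, rule_format, of 1 "[0..<l]" x]
        unfolding block_shift by (simp add: block_def)
      also have "\<dots> = path_weight s \<mu> x"
        using \<open>s \<le> l\<close> that by (intro prob_block_eq_path_weight assms(1,2,5) \<mu>)
      finally show ?thesis .
    qed
    then show ?thesis
      unfolding p_def prob_block_in[OF assms(1,2), of "\<lambda>x. empirical s x \<in> \<Gamma>"] by (intro sum.cong) auto
  qed
  have D: "cond_rel_entropy s \<nu> \<mu> = ereal (cond_entropy s \<nu> \<mu>)" if "stationary (Suc s) \<nu>" for \<nu>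
    using cond_rel_entropy_eq[OF that[THEN stationary_imp_prob_dist] pos] by simp
  show "\<forall>l\<ge>s. \<forall>\<omega>\<in>space M. empirical s (block X 1 l \<omega>) \<in> stationary_dists (s + 1)"
  proof (intro allI impI ballI)
    fix l \<omega> assume "s \<le> l"
    moreover have len: "length (block X 1 l \<omega>) = l" by (simp add: block_def)
    moreover have "block X 1 l \<omega> \<noteq> []" using len \<open>s \<le> l\<close> assms(3) by fastforce
    ultimately show "empirical s (block X 1 l \<omega>) \<in> stationary_dists (s + 1)"
      using stationary_empirical[of s "block X 1 l \<omega>"] assms(3)
      by (auto simp: stationary_dists_def simp del: stationary.simps)
  qed
  show "satisfies_LDP M (stationary_topology (s + 1))
      (\<lambda>\<nu>. cond_rel_entropy s \<nu> \<mu>) (\<lambda>l \<omega>. empirical s (block X 1 l \<omega>))"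
    unfolding satisfies_LDP_def p_def[symmetric]
  proof (intro conjI allI impI)
    fix \<Gamma> :: "('a list \<Rightarrow> real) set"
    assume op: "openin (stationary_topology (s + 1)) \<Gamma>"
    \<comment> \<open>Negated, the bound can be checked at each \<open>\<nu>\<close> of
      \<open>\<Gamma>\<close> separately.\<close>
    have "- liminf (\<lambda>l. ereal (1 / real l) * log_prob (p \<Gamma> l)) \<le> (INF \<nu>\<in>\<Gamma>. cond_rel_entropy s \<nu> \<mu>)"
    proof (rule INF_greatest)
      fix \<nu> assume "\<nu> \<in> \<Gamma>"
      have nu: "stationary (Suc s) \<nu>"
        using openin_subset[OF op] \<open>\<nu> \<in> \<Gamma>\<close> by (auto simp: stationary_dists_def simp del: stationary.simps)
      obtain \<epsilon> where \<epsilon>: "0 < \<epsilon>"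
        "\<And>\<kappa>. stationary (Suc s) \<kappa> \<Longrightarrow> l1_dist (Suc s) \<kappa> \<nu> < \<epsilon> \<Longrightarrow> \<kappa> \<in> \<Gamma>"
        using openin_stationary_topologyE[OF op \<open>\<nu> \<in> \<Gamma>\<close>] unfolding Suc_eq_plus1 by metis
      have "ereal (- cond_entropy s \<nu> \<mu>) \<le> liminf (\<lambda>l. ereal (1 / real l) * log_prob (p \<Gamma> l)) + ereal \<eta>"
        if \<eta>: "0 < \<eta>" for \<eta>
      proof -
        obtain C where C: "0 < C" "\<forall>\<^sub>F l in sequentially. C * exp (- real l * (cond_entropy s \<nu> \<mu> + \<eta>))
            \<le> (\<Sum>x | x \<in> tuples l \<and> empirical s x \<in> \<Gamma>. path_weight s \<mu> x)"
          by (rule path_weight_lower[OF nu stat pos \<epsilon>(1) \<eta> \<epsilon>(2)])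
        have "\<forall>\<^sub>F l in sequentially. C * exp (- real l * (cond_entropy s \<nu> \<mu> + \<eta>)) \<le> p \<Gamma> l"
          using C(2) eventually_ge_at_top[of s] by eventually_elim (simp add: p)
        from liminf_log_prob_ge[OF C(1) this]
        have "ereal (- (cond_entropy s \<nu> \<mu> + \<eta>)) + ereal \<eta>
            \<le> liminf (\<lambda>l. ereal (1 / real l) * log_prob (p \<Gamma> l)) + ereal \<eta>"
          by (rule add_right_mono)
        then show ?thesis by simp
      qed
      then have "ereal (- cond_entropy s \<nu> \<mu>) \<le> liminf (\<lambda>l. ereal (1 / real l) * log_prob (p \<Gamma> l))"
        by (rule ereal_le_epsilon2)
      then show "- liminf (\<lambda>l. ereal (1 / real l) * log_prob (p \<Gamma> l)) \<le> cond_rel_entropy s \<nu> \<mu>"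
        by (subst ereal_uminus_le_reorder) (simp add: D[OF nu])
    qed
    then show "- (INF \<nu>\<in>\<Gamma>. cond_rel_entropy s \<nu> \<mu>) \<le> liminf (\<lambda>l. ereal (1 / real l) * log_prob (p \<Gamma> l))"
      by (subst ereal_uminus_le_reorder)
  next
    fix \<Gamma> :: "('a list \<Rightarrow> real) set"
    assume "closedin (stationary_topology (s + 1)) \<Gamma>"
    then have sub: "stationary (Suc s) \<nu>" if "\<nu> \<in> \<Gamma>" for \<nu>
      using closedin_subset that by (fastforce simp: stationary_dists_def simp del: stationary.simps)
    show "limsup (\<lambda>l. ereal (1 / real l) * log_prob (p \<Gamma> l)) \<le> - (INF \<nu>\<in>\<Gamma>. cond_rel_entropy s \<nu> \<mu>)"
    proof (cases "\<Gamma> = {}")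
      case True
      \<comment> \<open>The infimum over the empty set is \<open>\<infinity>\<close>, so the value
        must be \<open>- \<infinity>\<close>. At \<open>l = 0\<close> the factor
        \<open>1 / real l\<close> is 0, which is why only positive \<open>l\<close> are
        considered.\<close>
      have "\<forall>\<^sub>F l in sequentially. ereal (1 / real l) * log_prob (p \<Gamma> l) \<le> - \<infinity>"
        using eventually_gt_at_top[of 0] by eventually_elim (simp add: True p_def log_prob_def)
      then have "limsup (\<lambda>l. ereal (1 / real l) * log_prob (p \<Gamma> l)) \<le> - \<infinity>"
        by (rule Limsup_bounded)
      then show ?thesis by simp
    next
      case False
      define d where "d = (INF \<nu>\<in>\<Gamma>. cond_entropy s \<nu> \<mu>)"
      have bdd: "bdd_below ((\<lambda>\<nu>. cond_entropy s \<nu> \<mu>) ` \<Gamma>)"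
        using cond_entropy_nonneg[OF sub[THEN stationary_imp_prob_dist] pd pos] by (intro bdd_belowI2)
      obtain K where K: "0 < K" "\<And>l \<Gamma> d. s \<le> l \<Longrightarrow> 0 < l \<Longrightarrow>
          (\<And>\<nu>. \<nu> \<in> \<Gamma> \<Longrightarrow> stationary (Suc s) \<nu> \<Longrightarrow> d \<le> cond_entropy s \<nu> \<mu>) \<Longrightarrow>
          (\<Sum>x | x \<in> tuples l \<and> empirical s x \<in> \<Gamma>. path_weight s \<mu> x)
            \<le> K * (real l + 1) ^ card (tuples (Suc s) :: 'a list set) * exp (- real l * d)"
        using path_weight_upper[OF pd pos] by blast
      have upper: "\<forall>\<^sub>F l in sequentially. p \<Gamma> l
          \<le> K * (real l + 1) ^ card (tuples (Suc s) :: 'a list set) * exp (- real l * d)"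
        using eventually_ge_at_top[of "Suc s"]
      proof eventually_elim
        case (elim l)
        then have "s \<le> l" "0 < l" by auto
        then show ?case
          unfolding p[OF \<open>s \<le> l\<close>] by (rule K(2)) (simp add: d_def cINF_lower[OF bdd])
      qed
      have "limsup (\<lambda>l. ereal (1 / real l) * log_prob (p \<Gamma> l)) \<le> ereal (- d)"
        by (rule limsup_log_prob_le[OF K(1) _ upper]) (simp add: p_def)
      also have "ereal (- d) = - (INF \<nu>\<in>\<Gamma>. cond_rel_entropy s \<nu> \<mu>)"
      proof -
        \<comment> \<open>A member of \<open>\<Gamma>\<close> bounds the infimum above and
          nonnegativity of the entropy bounds it below; being finite, it agrees with the infimum
          \<open>d\<close> taken in the reals.\<close>
        let ?J = "INF \<nu>\<in>\<Gamma>. ereal (cond_entropy s \<nu> \<mu>)"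
        obtain \<nu> where "\<nu> \<in> \<Gamma>" using False by blast
        then have "?J \<le> ereal (cond_entropy s \<nu> \<mu>)" by (rule INF_lower)
        moreover have "0 \<le> ?J"
          using cond_entropy_nonneg[OF sub[THEN stationary_imp_prob_dist] pd pos] by (intro INF_greatest) simp
        ultimately have "\<bar>?J\<bar> \<noteq> \<infinity>" by auto
        then have "ereal d = ?J" unfolding d_def by (rule ereal_INF)
        also have "?J = (INF \<nu>\<in>\<Gamma>. cond_rel_entropy s \<nu> \<mu>)"
          by (rule INF_cong) (simp_all only: D sub)
        finally show ?thesis by (simp flip: uminus_ereal.simps)
      qed
      finally show ?thesis .
    qed
  qed
qed

end
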